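(* The model-checking problem for HyperSt$^2$ over memoryful probabilistic strategies (i.e., given a finite turn-based stochastic game $\mathcal{G}$ and a well-formed HyperSt$^2$ formula $\varphi$, decide whether $\mathcal{G}\models\varphi$, where strategy quantifiers range over all strategies) is undecidable.
   Context: A TSG is $\mathcal{G}=(\mathit{Ags},S,\mathit{Act},P,AP,L)$ with $\mathit{Ags}=\{1,\dots,k\}$, states $S$ partitioned into $S_g$, finite $\mathit{Act}$, $P:S\times\mathit{Act}\times S\to[0,1]$ with $\mathit{Act}(s)=\{a:\sum_{s'}P(s,a,s')=1\}\ne\emptyset$ and $\sum_{s'}P(s,a,s')=0$ for $a\notin\mathit{Act}(s)$, $L:S\to2^{AP}$ (finite instances have finitely many states and rational probabilities). An $A$-strategy ($A\subseteq\mathit{Ags}$) is $(Q,\mathit{init},\mathit{mode},\mathit{act})$ with $Q$ a countable nonempty set of modes, $\mathit{init}:S\to Q$, $\mathit{mode}:Q\times S\to Q$, $\mathit{act}(q,s,\cdot)$ a probability distribution on $\mathit{Act}(s)$ for $s\in S_A=\bigcup_{g\in A}S_g$. $\alpha|_g$ restricts $\mathit{act}$ to $S_{\{g\}}$; for disjoint agent sets $\alpha\oplus\beta$ has modes $Q_\alpha\times Q_\beta$, componentwise init/mode and uses $\beta$ on $S_B$, $\alpha$ on $S_A$. For a joint strategy $\alpha$, $\mathcal{G}^\alpha$ is the DTMC on $S\times Q$ with $P((s,q),(s',q'))=\sum_aP(s,a,s')\mathit{act}(q,s,a)$ if $q'=\mathit{mode}(q,s)$, else $0$, labels $L(s)$;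 compositions of DTMCs take tuples, product probabilities and indexed labels. HyperSt$^2$ syntax: $\varphi::=\exists x\varphi\mid\forall x\varphi\mid\psi$; $\psi::=\langle\langle A\rangle\rangle_X\psi\mid[[A]]_X\psi\mid\theta$; $\theta::=\mathit{true}\mid p_x\mid\theta\wedge\theta\mid\neg\theta\mid\rho\sim\rho\mid x=x'\mid\psi$; $\rho::=\mathbb{P}(\vartheta)\mid f(\rho,\dots,\rho)$; $\vartheta::=\mathsf{X}\theta\mid\theta\mathsf{U}\theta$ ($A\subseteq\mathit{Ags}$, $X$ a set of state variables, $\sim\in\{\le,<,=,>,\ge\}$, $f$ standard arithmetic operations incl. constants). Well-formed: each $p_x$ in scope of a quantifier for $x$; each strategy quantifier for $\{x_1,\dots,x_m\}$ in scope of state quantifiers for them; each $\mathbb{P}$ in scope of strategy quantifiers for all agents and all state variables; all state quantifiers in front. Semantics on contexts $(\mathcal{G},\mathit{map},v)$ ($\mathit{map}(x,g)$ a $\{g\}$-strategy, $v(x)\in S$), $\mathcal{G}\models\varphi$ iff $(\mathcal{G},\emptyset,\emptyset)\models\varphi$: state quantifiers range over $S$; $\langle\langle A\rangle\rangle_X\psi$ ($[[A]]_X\psi$) holds iff for some (all) $A$-strategies $\alpha$, $\psi$ holds with $\mathit{map}(x,g):=\alpha|_g$ for $g\in A$, $x\in X$; $p_x$ iff $p\in L(v(x))$; Booleans, comparisons, $x=x'$ iff $v(x)=v(x')$; $\mathbb{P}(\vartheta)$ is the probability in $\mathcal{G}^{\alpha_1}\times\dots\times\mathcal{G}^{\alpha_n}$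 ($\alpha_i=\bigoplus_g\mathit{map}(x_i,g)$) from $((v(x_i),\mathit{init}_i(v(x_i))))_i$ of paths satisfying $\vartheta$; $\mathsf{X}\theta$, $\theta_1\mathsf{U}\theta_2$ on a product path $\pi$ evaluate the $\theta$'s at position $j$ with $v(x_i)$ the $S$-component $s_i$ of $(\pi[j])_i$ and $\mathit{map}(x_i,g)$ the restriction to $g$ of $\alpha_i$ with initial mode fixed to the mode component $q_i$ of $(\pi[j])_i$. *)

theory Defs
  imports "HOL-Probability.Probability" "HOL-Library.FSet" "HOL-Library.Nat_Bijection"
begin

section \<open>Turn-based stochastic games\<close>

text \<open>States, actions, atomic propositions and state variables are named by natural numbers,
  so that every countable game is represented up to renaming.\<close>

type_synonym agent = nat
type_synonym state = nat
type_synonym action = nat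
type_synonym aprop = nat
type_synonym svar = nat

record tsg =
  num_agents :: nat
  states :: "state set"
  owner :: "state \<Rightarrow> agent"
  actions :: "action set"
  trans :: "state \<Rightarrow> action \<Rightarrow> state \<Rightarrow> real"
  aprops :: "aprop set"
  label :: "state \<Rightarrow> aprop set"

definition agents :: "tsg \<Rightarrow> agent set" where
  "agents G = {1..num_agents G}"

definition states_of :: "tsg \<Rightarrow> agent set \<Rightarrow> state set" where
  "states_of G A = {s \<in> states G. owner G s \<in> A}"

definition enabled :: "tsg \<Rightarrow> state \<Rightarrow> action set" where
  "enabled G s = {a \<in> actions G. (trans G s a has_sum 1) (states G)}"

definition is_tsg :: "tsg \<Rightarrow> bool" where
  "is_tsg G \<longleftrightarrow>
     num_agents G \<ge> 1 \<and> finite (actions G) \<and>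
     (\<forall>s\<in>states G. owner G s \<in> agents G \<and> label G s \<subseteq> aprops G \<and> enabled G s \<noteq> {}) \<and>
     (\<forall>s\<in>states G. \<forall>a\<in>actions G. \<forall>s'\<in>states G. 0 \<le> trans G s a s' \<and> trans G s a s' \<le> 1) \<and>
     (\<forall>s\<in>states G. \<forall>a\<in>actions G - enabled G s. (trans G s a has_sum 0) (states G))"


section \<open>Strategies\<close>

text \<open>A countable nonempty set of modes is, up to renaming, a nonempty set of natural numbers;
  pairs of modes are named through \<^const>\<open>prod_encode\<close>.\<close>

record strategy =
  modes :: "nat set"
  init :: "state \<Rightarrow> nat"
  mode :: "nat \<Rightarrow> state \<Rightarrow> nat"
  act :: "nat \<Rightarrow> state \<Rightarrow> action pmf"

definition is_strategy :: "tsg \<Rightarrow> agent set \<Rightarrow> strategy \<Rightarrow> bool" where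
  "is_strategy G A \<alpha> \<longleftrightarrow>
     modes \<alpha> \<noteq> {} \<and>
     (\<forall>s\<in>states G. init \<alpha> s \<in> modes \<alpha>) \<and>
     (\<forall>q\<in>modes \<alpha>. \<forall>s\<in>states G. mode \<alpha> q s \<in> modes \<alpha>) \<and>
     (\<forall>q\<in>modes \<alpha>. \<forall>s\<in>states_of G A. set_pmf (act \<alpha> q s) \<subseteq> enabled G s)"

definition restrict_strategy :: "tsg \<Rightarrow> agent \<Rightarrow> strategy \<Rightarrow> strategy" where
  "restrict_strategy G g \<alpha> =
     \<alpha>\<lparr>act := \<lambda>q s. if s \<in> states_of G {g} then act \<alpha> q s else undefined\<rparr>"

definition compose :: "tsg \<Rightarrow> strategy \<Rightarrow> agent set \<Rightarrow> strategy \<Rightarrow> strategy" where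
  "compose G \<alpha> B \<beta> =
     \<lparr>modes = prod_encode ` (modes \<alpha> \<times> modes \<beta>),
      init = \<lambda>s. prod_encode (init \<alpha> s, init \<beta> s),
      mode = \<lambda>q s. (case prod_decode q of (q1, q2) \<Rightarrow> prod_encode (mode \<alpha> q1 s, mode \<beta> q2 s)),
      act = \<lambda>q s. (case prod_decode q of (q1, q2) \<Rightarrow>
              if s \<in> states_of G B then act \<beta> q2 s else act \<alpha> q1 s)\<rparr>"

definition joint :: "tsg \<Rightarrow> (agent \<Rightarrow> strategy) \<Rightarrow> strategy" where
  "joint G m = foldl (\<lambda>\<alpha> g. compose G \<alpha> {g} (m g)) (m 1) [2..<Suc (num_agents G)]"


section \<open>Discrete-time Markov chains\<close>

text \<open>Labels of chains are left out: atomic propositions are read off the label function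
  of the game at the state component.\<close>

record 'a dtmc =
  dstates :: "'a set"
  dprob :: "'a \<Rightarrow> 'a \<Rightarrow> real"

definition induced :: "tsg \<Rightarrow> strategy \<Rightarrow> (state \<times> nat) dtmc" where
  "induced G \<alpha> =
     \<lparr>dstates = states G \<times> modes \<alpha>,
      dprob = \<lambda>(s, q) (s', q').
        if q' = mode \<alpha> q s then \<Sum>a\<in>actions G. trans G s a s' * pmf (act \<alpha> q s) a else 0\<rparr>"

text \<open>The tuple composition, with components indexed by a finite set \<open>V\<close>.\<close>

definition product_dtmc :: "'i set \<Rightarrow> ('i \<Rightarrow> 'a dtmc) \<Rightarrow> ('i \<Rightarrow> 'a) dtmc" where
  "product_dtmc V D =
     \<lparr>dstates = (\<Pi>\<^sub>E x\<in>V. dstates (D x)),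
      dprob = \<lambda>c c'. \<Prod>x\<in>V. dprob (D x) (c x) (c' x)\<rparr>"

definition path_kernel :: "'a dtmc \<Rightarrow> 'a \<Rightarrow> nat \<Rightarrow> (nat \<Rightarrow> 'a) \<Rightarrow> 'a measure" where
  "path_kernel D c i \<omega> =
     (if i = 0 then return (count_space (dstates D)) c
      else density (count_space (dstates D)) (\<lambda>c'. ennreal (dprob D (\<omega> (i - 1)) c')))"

text \<open>The measure on infinite paths given by the Ionescu-Tulcea theorem.\<close>

definition path_measure :: "'a dtmc \<Rightarrow> 'a \<Rightarrow> (nat \<Rightarrow> 'a) measure" where
  "path_measure D c =
     projective_family.lim UNIV
       (Ionescu_Tulcea.CI (path_kernel D c) (\<lambda>_. count_space (dstates D)))
       (\<lambda>_. count_space (dstates D))"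


section \<open>Syntax\<close>

datatype cmp = CLe | CLt | CEq | CGt | CGe

text \<open>Division, being partial, is not included. Constants are rational, so that formulas have finite
  descriptions.\<close>

datatype arith = APlus | AMinus | ATimes

text \<open>The nonterminals \<open>\<psi>\<close> and \<open>\<theta>\<close> of the grammar produce one another by unit rules
  and so generate the same formulas; both are rendered by \<open>form\<close>.\<close>

datatype form =
    StEx "agent fset" "svar fset" form
  | StAll "agent fset" "svar fset" form
  | TT
  | Atom aprop svar
  | Conj form form
  | Neg form
  | Cmp cmp pexp pexp
  | VEq svar svar
and pexp =
    Prob pform
  | Const rat
  | Arith arith pexp pexp
and pform =
    Next form
  | Until form form

datatype hform =
    Ex svar hform
  | All svar hform
  | Matrix form

text \<open>\<open>V\<close> collects the state variables in scope; \<open>C\<close> the pairs of a state variable and an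
  agent in the scope of a strategy quantifier for them.\<close>

primrec wf_form :: "tsg \<Rightarrow> svar set \<Rightarrow> (svar \<times> agent) set \<Rightarrow> form \<Rightarrow> bool"
  and wf_pexp :: "tsg \<Rightarrow> svar set \<Rightarrow> (svar \<times> agent) set \<Rightarrow> pexp \<Rightarrow> bool"
  and wf_pform :: "tsg \<Rightarrow> svar set \<Rightarrow> (svar \<times> agent) set \<Rightarrow> pform \<Rightarrow> bool"
where
  "wf_form G V C (StEx A X \<psi>) \<longleftrightarrow>
     fset A \<subseteq> agents G \<and> fset X \<subseteq> V \<and> wf_form G V (C \<union> fset X \<times> fset A) \<psi>"
| "wf_form G V C (StAll A X \<psi>) \<longleftrightarrow>
     fset A \<subseteq> agents G \<and> fset X \<subseteq> V \<and> wf_form G V (C \<union> fset X \<times> fset A) \<psi>"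
| "wf_form G V C TT \<longleftrightarrow> True"
| "wf_form G V C (Atom p x) \<longleftrightarrow> p \<in> aprops G \<and> x \<in> V"
| "wf_form G V C (Conj \<theta>1 \<theta>2) \<longleftrightarrow> wf_form G V C \<theta>1 \<and> wf_form G V C \<theta>2"
| "wf_form G V C (Neg \<theta>) \<longleftrightarrow> wf_form G V C \<theta>"
| "wf_form G V C (Cmp r \<rho>1 \<rho>2) \<longleftrightarrow> wf_pexp G V C \<rho>1 \<and> wf_pexp G V C \<rho>2"
| "wf_form G V C (VEq x x') \<longleftrightarrow> x \<in> V \<and> x' \<in> V"
| "wf_pexp G V C (Prob \<phi>) \<longleftrightarrow> V \<times> agents G \<subseteq> C \<and> wf_pform G V C \<phi>"
| "wf_pexp G V C (Const c) \<longleftrightarrow> True"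
| "wf_pexp G V C (Arith f \<rho>1 \<rho>2) \<longleftrightarrow> wf_pexp G V C \<rho>1 \<and> wf_pexp G V C \<rho>2"
| "wf_pform G V C (Next \<theta>) \<longleftrightarrow> wf_form G V C \<theta>"
| "wf_pform G V C (Until \<theta>1 \<theta>2) \<longleftrightarrow> wf_form G V C \<theta>1 \<and> wf_form G V C \<theta>2"

primrec wf_hform :: "tsg \<Rightarrow> svar set \<Rightarrow> hform \<Rightarrow> bool" where
  "wf_hform G V (Ex x \<phi>) \<longleftrightarrow> wf_hform G (insert x V) \<phi>"
| "wf_hform G V (All x \<phi>) \<longleftrightarrow> wf_hform G (insert x V) \<phi>"
| "wf_hform G V (Matrix \<psi>) \<longleftrightarrow> wf_form G V {} \<psi>"

definition well_formed :: "tsg \<Rightarrow> hform \<Rightarrow> bool" where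
  "well_formed G \<phi> \<longleftrightarrow> wf_hform G {} \<phi>"


section \<open>Semantics\<close>

type_synonym strategy_map = "svar \<Rightarrow> agent \<rightharpoonup> strategy"
type_synonym valuation = "svar \<rightharpoonup> state"

definition assign :: "tsg \<Rightarrow> strategy_map \<Rightarrow> agent set \<Rightarrow> svar set \<Rightarrow> strategy \<Rightarrow> strategy_map" where
  "assign G m A X \<alpha> =
     (\<lambda>x g. if x \<in> X \<and> g \<in> A then Some (restrict_strategy G g \<alpha>) else m x g)"

definition joint_at :: "tsg \<Rightarrow> strategy_map \<Rightarrow> svar \<Rightarrow> strategy" where
  "joint_at G m x = joint G (\<lambda>g. the (m x g))"

definition context_paths ::
    "tsg \<Rightarrow> strategy_map \<Rightarrow> valuation \<Rightarrow> (nat \<Rightarrow> svar \<Rightarrow> state \<times> nat) measure" where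
  "context_paths G m v =
     path_measure (product_dtmc (dom v) (\<lambda>x. induced G (joint_at G m x)))
       (\<lambda>x\<in>dom v. (the (v x), init (joint_at G m x) (the (v x))))"

definition map_at :: "tsg \<Rightarrow> strategy_map \<Rightarrow> valuation \<Rightarrow> (svar \<Rightarrow> state \<times> nat) \<Rightarrow> strategy_map" where
  "map_at G m v c =
     (\<lambda>x g. if x \<in> dom v \<and> g \<in> agents G
            then Some ((restrict_strategy G g (joint_at G m x))\<lparr>init := \<lambda>_. snd (c x)\<rparr>)
            else None)"

definition val_at :: "valuation \<Rightarrow> (svar \<Rightarrow> state \<times> nat) \<Rightarrow> valuation" where
  "val_at v c = (\<lambda>x. if x \<in> dom v then Some (fst (c x)) else None)"

fun cmp_sem :: "cmp \<Rightarrow> real \<Rightarrow> real \<Rightarrow> bool" where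
  "cmp_sem CLe a b \<longleftrightarrow> a \<le> b"
| "cmp_sem CLt a b \<longleftrightarrow> a < b"
| "cmp_sem CEq a b \<longleftrightarrow> a = b"
| "cmp_sem CGt a b \<longleftrightarrow> a > b"
| "cmp_sem CGe a b \<longleftrightarrow> a \<ge> b"

fun arith_sem :: "arith \<Rightarrow> real \<Rightarrow> real \<Rightarrow> real" where
  "arith_sem APlus a b = a + b"
| "arith_sem AMinus a b = a - b"
| "arith_sem ATimes a b = a * b"

primrec sat :: "tsg \<Rightarrow> strategy_map \<Rightarrow> valuation \<Rightarrow> form \<Rightarrow> bool"
  and val :: "tsg \<Rightarrow> strategy_map \<Rightarrow> valuation \<Rightarrow> pexp \<Rightarrow> real"
  and psat :: "tsg \<Rightarrow> strategy_map \<Rightarrow> valuation \<Rightarrow> pform \<Rightarrow> (nat \<Rightarrow> svar \<Rightarrow> state \<times> nat) \<Rightarrow> bool"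
where
  "sat G m v (StEx A X \<psi>) \<longleftrightarrow>
     (\<exists>\<alpha>. is_strategy G (fset A) \<alpha> \<and> sat G (assign G m (fset A) (fset X) \<alpha>) v \<psi>)"
| "sat G m v (StAll A X \<psi>) \<longleftrightarrow>
     (\<forall>\<alpha>. is_strategy G (fset A) \<alpha> \<longrightarrow> sat G (assign G m (fset A) (fset X) \<alpha>) v \<psi>)"
| "sat G m v TT \<longleftrightarrow> True"
| "sat G m v (Atom p x) \<longleftrightarrow> p \<in> label G (the (v x))"
| "sat G m v (Conj \<theta>1 \<theta>2) \<longleftrightarrow> sat G m v \<theta>1 \<and> sat G m v \<theta>2"
| "sat G m v (Neg \<theta>) \<longleftrightarrow> \<not> sat G m v \<theta>"
| "sat G m v (Cmp r \<rho>1 \<rho>2) \<longleftrightarrow> cmp_sem r (val G m v \<rho>1) (val G m v \<rho>2)"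
| "sat G m v (VEq x x') \<longleftrightarrow> v x = v x'"
| "val G m v (Prob \<phi>) =
     measure (context_paths G m v) {\<pi> \<in> space (context_paths G m v). psat G m v \<phi> \<pi>}"
| "val G m v (Const c) = of_rat c"
| "val G m v (Arith f \<rho>1 \<rho>2) = arith_sem f (val G m v \<rho>1) (val G m v \<rho>2)"
| "psat G m v (Next \<theta>) \<pi> \<longleftrightarrow> sat G (map_at G m v (\<pi> 1)) (val_at v (\<pi> 1)) \<theta>"
| "psat G m v (Until \<theta>1 \<theta>2) \<pi> \<longleftrightarrow>
     (\<exists>j. sat G (map_at G m v (\<pi> j)) (val_at v (\<pi> j)) \<theta>2 \<and>
          (\<forall>i<j. sat G (map_at G m v (\<pi> i)) (val_at v (\<pi> i)) \<theta>1))"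

primrec hsat :: "tsg \<Rightarrow> valuation \<Rightarrow> hform \<Rightarrow> bool" where
  "hsat G v (Ex x \<phi>) \<longleftrightarrow> (\<exists>s\<in>states G. hsat G (v(x \<mapsto> s)) \<phi>)"
| "hsat G v (All x \<phi>) \<longleftrightarrow> (\<forall>s\<in>states G. hsat G (v(x \<mapsto> s)) \<phi>)"
| "hsat G v (Matrix \<psi>) \<longleftrightarrow> sat G (\<lambda>_. Map.empty) v \<psi>"

definition models :: "tsg \<Rightarrow> hform \<Rightarrow> bool" where
  "models G \<phi> \<longleftrightarrow> hsat G Map.empty \<phi>"


section \<open>Finite instances\<close>

text \<open>A finite presentation of a game: the states are the indices of \<open>f_owner\<close>, and
  \<open>f_trans ! s ! a ! s'\<close> is the transition probability. Up to renaming, every finite game with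
  rational probabilities is presented in this way.\<close>

datatype fin_game = FinGame
  (f_agents: nat) (f_owner: "agent list") (f_actions: nat)
  (f_trans: "rat list list list") (f_aprops: nat) (f_label: "aprop fset list")

definition game_of :: "fin_game \<Rightarrow> tsg" where
  "game_of F =
     \<lparr>num_agents = f_agents F,
      states = {..<length (f_owner F)},
      owner = \<lambda>s. f_owner F ! s,
      actions = {..<f_actions F},
      trans = \<lambda>s a s'. of_rat (f_trans F ! s ! a ! s'),
      aprops = {..<f_aprops F},
      label = \<lambda>s. fset (f_label F ! s)\<rparr>"

definition is_fin_game :: "fin_game \<Rightarrow> bool" where
  "is_fin_game F \<longleftrightarrow>
     length (f_label F) = length (f_owner F) \<and>
     length (f_trans F) = length (f_owner F) \<and>
     (\<forall>r\<in>set (f_trans F). length r = f_actions F \<and> (\<forall>d\<in>set r. length d = length (f_owner F))) \<and>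
     is_tsg (game_of F)"

definition code_rat :: "rat \<Rightarrow> nat" where
  "code_rat r = (case quotient_of r of (a, b) \<Rightarrow> prod_encode (int_encode a, int_encode b))"

definition code_fset :: "nat fset \<Rightarrow> nat" where
  "code_fset X = set_encode (fset X)"

definition code_game :: "fin_game \<Rightarrow> nat" where
  "code_game F = list_encode
     [f_agents F, list_encode (f_owner F), f_actions F,
      list_encode (map (\<lambda>r. list_encode (map (\<lambda>d. list_encode (map code_rat d)) r)) (f_trans F)),
      f_aprops F, list_encode (map code_fset (f_label F))]"

fun code_cmp :: "cmp \<Rightarrow> nat" where
  "code_cmp CLe = 0" | "code_cmp CLt = 1" | "code_cmp CEq = 2"
| "code_cmp CGt = 3" | "code_cmp CGe = 4"

fun code_arith :: "arith \<Rightarrow> nat" where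
  "code_arith APlus = 0" | "code_arith AMinus = 1" | "code_arith ATimes = 2"

primrec code_form :: "form \<Rightarrow> nat" and code_pexp :: "pexp \<Rightarrow> nat" and code_pform :: "pform \<Rightarrow> nat"
where
  "code_form (StEx A X \<psi>) = list_encode [0, code_fset A, code_fset X, code_form \<psi>]"
| "code_form (StAll A X \<psi>) = list_encode [1, code_fset A, code_fset X, code_form \<psi>]"
| "code_form TT = list_encode [2]"
| "code_form (Atom p x) = list_encode [3, p, x]"
| "code_form (Conj \<theta>1 \<theta>2) = list_encode [4, code_form \<theta>1, code_form \<theta>2]"
| "code_form (Neg \<theta>) = list_encode [5, code_form \<theta>]"
| "code_form (Cmp r \<rho>1 \<rho>2) = list_encode [6, code_cmp r, code_pexp \<rho>1, code_pexp \<rho>2]"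
| "code_form (VEq x x') = list_encode [7, x, x']"
| "code_pexp (Prob \<phi>) = list_encode [0, code_pform \<phi>]"
| "code_pexp (Const c) = list_encode [1, code_rat c]"
| "code_pexp (Arith f \<rho>1 \<rho>2) = list_encode [2, code_arith f, code_pexp \<rho>1, code_pexp \<rho>2]"
| "code_pform (Next \<theta>) = list_encode [0, code_form \<theta>]"
| "code_pform (Until \<theta>1 \<theta>2) = list_encode [1, code_form \<theta>1, code_form \<theta>2]"

primrec code_hform :: "hform \<Rightarrow> nat" where
  "code_hform (Ex x \<phi>) = list_encode [0, x, code_hform \<phi>]"
| "code_hform (All x \<phi>) = list_encode [1, x, code_hform \<phi>]"
| "code_hform (Matrix \<psi>) = list_encode [2, code_form \<psi>]"

definition code_instance :: "fin_game \<times> hform \<Rightarrow> nat" where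
  "code_instance = (\<lambda>(F, \<phi>). prod_encode (code_game F, code_hform \<phi>))"

definition mc_instances :: "(fin_game \<times> hform) set" where
  "mc_instances = {(F, \<phi>). is_fin_game F \<and> well_formed (game_of F) \<phi>}"

definition mc_holds :: "fin_game \<times> hform \<Rightarrow> bool" where
  "mc_holds = (\<lambda>(F, \<phi>). models (game_of F) \<phi>)"

lemma code_rat_inj: "code_rat r = code_rat r' \<longleftrightarrow> r = r'"
  by (auto simp: code_rat_def int_encode_eq quotient_of_inject split: prod.splits)

lemma code_fset_inj: "code_fset X = code_fset Y \<longleftrightarrow> X = Y"
  by (simp add: code_fset_def set_encode_eq fset_inject)

lemma inj_code_game: "inj code_game"
proof (rule injI)
  fix F F'
  assume "code_game F = code_game F'"
  moreover have "inj (map (\<lambda>r. list_encode (map (\<lambda>d. list_encode (map code_rat d)) r)))"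
  proof -
    have rat: "inj (map code_rat)"
      by (intro inj_mapI injI) (simp add: code_rat_inj)
    have "inj (map (\<lambda>d. list_encode (map code_rat d)))"
      by (intro inj_mapI injI) (simp add: list_encode_eq inj_eq[OF rat])
    then show ?thesis
      by (intro inj_mapI injI) (simp add: list_encode_eq inj_eq)
  qed
  moreover have "inj (map code_fset)"
    by (intro inj_mapI injI) (simp add: code_fset_inj)
  ultimately show "F = F'"
    by (intro fin_game.expand conjI) (simp_all add: code_game_def list_encode_eq inj_eq)
qed

lemma code_cmp_inj: "code_cmp r = code_cmp r' \<longleftrightarrow> r = r'"
  by (cases r; cases r') simp_all

lemma code_arith_inj: "code_arith f = code_arith f' \<longleftrightarrow> f = f'"
  by (cases f; cases f') simp_all

lemma code_form_inj:
  "code_form \<theta> = code_form \<theta>' \<longleftrightarrow> \<theta> = \<theta>'"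
  "code_pexp \<rho> = code_pexp \<rho>' \<longleftrightarrow> \<rho> = \<rho>'"
  "code_pform \<phi> = code_pform \<phi>' \<longleftrightarrow> \<phi> = \<phi>'"
proof (induction \<theta> and \<rho> and \<phi> arbitrary: \<theta>' and \<rho>' and \<phi>')
  case (StEx A X \<psi>) then show ?case by (cases \<theta>') (simp_all add: list_encode_eq code_fset_inj del: list_encode.simps)
next
  case (StAll A X \<psi>) then show ?case by (cases \<theta>') (simp_all add: list_encode_eq code_fset_inj del: list_encode.simps)
next
  case TT show ?case by (cases \<theta>') (simp_all add: list_encode_eq del: list_encode.simps)
next
  case (Atom p x) show ?case by (cases \<theta>') (simp_all add: list_encode_eq del: list_encode.simps)
next
  case (Conj \<theta>1 \<theta>2) then show ?case by (cases \<theta>') (simp_all add: list_encode_eq del: list_encode.simps)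
next
  case (Neg \<theta>) then show ?case by (cases \<theta>') (simp_all add: list_encode_eq del: list_encode.simps)
next
  case (Cmp r \<rho>1 \<rho>2) then show ?case by (cases \<theta>') (simp_all add: list_encode_eq code_cmp_inj del: list_encode.simps)
next
  case (VEq x x') show ?case by (cases \<theta>') (simp_all add: list_encode_eq del: list_encode.simps)
next
  case (Prob \<phi>) then show ?case by (cases \<rho>') (simp_all add: list_encode_eq del: list_encode.simps)
next
  case (Const c) show ?case by (cases \<rho>') (simp_all add: list_encode_eq code_rat_inj del: list_encode.simps)
next
  case (Arith f \<rho>1 \<rho>2) then show ?case
    by (cases \<rho>') (simp_all add: list_encode_eq code_arith_inj del: list_encode.simps)
next
  case (Next \<theta>) then show ?case by (cases \<phi>') (simp_all add: list_encode_eq del: list_encode.simps)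
next
  case (Until \<theta>1 \<theta>2) then show ?case by (cases \<phi>') (simp_all add: list_encode_eq del: list_encode.simps)
qed

lemma code_hform_inj: "code_hform \<phi> = code_hform \<phi>' \<longleftrightarrow> \<phi> = \<phi>'"
proof (induction \<phi> arbitrary: \<phi>')
  case (Ex x \<phi>) then show ?case by (cases \<phi>') (simp_all add: list_encode_eq del: list_encode.simps)
next
  case (All x \<phi>) then show ?case by (cases \<phi>') (simp_all add: list_encode_eq del: list_encode.simps)
next
  case (Matrix \<psi>) show ?case by (cases \<phi>') (simp_all add: list_encode_eq code_form_inj del: list_encode.simps)
qed

lemma inj_code_instance: "inj code_instance"
  by (auto intro!: injI simp: code_instance_def code_hform_inj dest: injD[OF inj_code_game])


section \<open>Decidability\<close>

text \<open>Partial recursive functions; \<open>evaluates f xs y\<close> says that \<open>f\<close> is defined on the argument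
  tuple \<open>xs\<close> with value \<open>y\<close>.\<close>

datatype recf = Zero | Succ | Proj nat | Comp recf "recf list" | PrimRec recf recf | Mu recf

inductive evaluates :: "recf \<Rightarrow> nat list \<Rightarrow> nat \<Rightarrow> bool" where
  zero: "evaluates Zero xs 0"
| succ: "evaluates Succ [x] (Suc x)"
| proj: "i < length xs \<Longrightarrow> evaluates (Proj i) xs (xs ! i)"
| comp: "list_all2 (\<lambda>g y. evaluates g xs y) gs ys \<Longrightarrow> evaluates f ys z \<Longrightarrow>
    evaluates (Comp f gs) xs z"
| primrec_0: "evaluates f xs y \<Longrightarrow> evaluates (PrimRec f g) (0 # xs) y"
| primrec_Suc: "evaluates (PrimRec f g) (n # xs) r \<Longrightarrow> evaluates g (n # r # xs) y \<Longrightarrow>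
    evaluates (PrimRec f g) (Suc n # xs) y"
| mu: "evaluates f (n # xs) 0 \<Longrightarrow> (\<forall>k<n. \<exists>r>0. evaluates f (k # xs) r) \<Longrightarrow>
    evaluates (Mu f) xs n"

text \<open>The problem of deciding \<open>P\<close> for the inputs in \<open>I\<close>, given by their codes. Nothing is
  demanded of the deciding function on numbers that are not codes of inputs in \<open>I\<close>.\<close>

definition decidable_problem :: "('i \<Rightarrow> nat) \<Rightarrow> 'i set \<Rightarrow> ('i \<Rightarrow> bool) \<Rightarrow> bool" where
  "decidable_problem code I P \<longleftrightarrow>
     (\<exists>f. \<forall>i\<in>I. evaluates f [code i] (if P i then 1 else 0))"

end

theory Submission
  imports Defs "HOL-Number_Theory.Cong"
begin

text \<open>
  First-order arithmetic is interpreted in the model checker. In a one-agent game, state 0 lets the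
  strategy choose between staying, accepting (state 1) and rejecting (state 2). If at every visit of
  state 0 the probability of accepting at once is 0 or 1 and the probability of leaving at once
  equals the probability \<open>R\<close> of ever accepting, then, unless it accepts at once, \<open>R = (1 - R) * R'\<close>
  for the value \<open>R'\<close> after staying: \<open>1 / R\<close> counts down by one, and positive solutions are exactly
  the numbers \<open>R = 1 / (n + 1)\<close>. So strategies code natural numbers by \<open>n = 1 / R - 1\<close>, and strategy
  quantifiers become quantifiers over natural numbers; addition and multiplication are polynomial
  conditions on the codes.

  State 1 is left unchanged with probability \<open>1 / (p + 1)\<close>, which gives a formula access to
  the parameter \<open>p\<close> of the game without affecting the probability of reaching state 1. Given a
  decision procedure \<open>f\<close>, whose graph is arithmetical, take a formula \<open>\<phi>\<close> saying
  that \<open>f\<close> rejects the instance consisting of the game with parameter \<open>p\<close> and the formula coded by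
  \<open>p\<close>; choosing \<open>p\<close> as the code of \<open>\<phi>\<close> gives a contradiction.
\<close>

section \<open>Path measures of Markov chains\<close>

text \<open>The positions 0 to \<open>n\<close> are tested, the start included, so
  \<open>n = 0\<close> already tests \<open>c\<close>. Values in \<open>ennreal\<close> let
  integrals and infima be formed without integrability conditions.\<close>

primrec avoid :: "('a \<Rightarrow> 'a pmf) \<Rightarrow> ('a \<Rightarrow> bool) \<Rightarrow> nat \<Rightarrow> 'a \<Rightarrow> ennreal" where
  "avoid K Q 0 c = of_bool (\<not> Q c)"
| "avoid K Q (Suc n) c = of_bool (\<not> Q c) * (\<integral>\<^sup>+c'. avoid K Q n c' \<partial>measure_pmf (K c))"

text \<open>The avoidance probabilities decrease to the probability of never visiting
  \<open>Q\<close>; by \<open>measure_eventually\<close> the complement is the probability of a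
  visit.\<close>

definition reach :: "('a \<Rightarrow> 'a pmf) \<Rightarrow> ('a \<Rightarrow> bool) \<Rightarrow> 'a \<Rightarrow> real" where
  "reach K Q c = 1 - enn2real (INF n. avoid K Q n c)"

lemma avoid_le_1: "avoid K Q n c \<le> 1"
proof (induction n arbitrary: c)
  case (Suc n)
  have "(\<integral>\<^sup>+c'. avoid K Q n c' \<partial>measure_pmf (K c)) \<le> (\<integral>\<^sup>+c'. 1 \<partial>measure_pmf (K c))"
    by (intro nn_integral_mono Suc)
  then show ?case by (auto simp: of_bool_def)
qed (auto simp: of_bool_def)

text \<open>\<open>dprob\<close> is a bare real function. Here it is tied, on the states of the
  chain, to a kernel of probability mass functions, so that one-step integrals can be computed over
  \<open>K\<close>.\<close>

locale pmf_chain =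
  fixes D :: "'a dtmc" and K :: "'a \<Rightarrow> 'a pmf" and c :: 'a
  assumes countable_states: "countable (dstates D)"
    and start: "c \<in> dstates D"
    and closed: "\<And>s. s \<in> dstates D \<Longrightarrow> set_pmf (K s) \<subseteq> dstates D"
    and dprob_eq: "\<And>s s'. s \<in> dstates D \<Longrightarrow> s' \<in> dstates D \<Longrightarrow> dprob D s s' = pmf (K s) s'"
begin

abbreviation "S \<equiv> count_space (dstates D)"

text \<open>\<open>K s\<close> puts no mass outside \<open>dstates D\<close>, so summing over all
  points instead of over the states only adds zeros.\<close>

lemma nn_integral_kernel:
  assumes "s \<in> dstates D"
  shows "(\<integral>\<^sup>+x. f x \<partial>density S (\<lambda>c'. ennreal (dprob D s c'))) = (\<integral>\<^sup>+x. f x \<partial>measure_pmf (K s))"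
proof -
  have "(\<integral>\<^sup>+x. f x \<partial>density S (\<lambda>c'. ennreal (dprob D s c'))) = (\<integral>\<^sup>+x. ennreal (pmf (K s) x) * f x \<partial>S)"
    by (subst nn_integral_density) (auto intro!: nn_integral_cong simp: dprob_eq assms)
  also have "\<dots> = (\<integral>\<^sup>+x. ennreal (pmf (K s) x) * f x \<partial>count_space UNIV)"
    using closed[OF assms]
    by (intro nn_integral_count_space_eq) (auto simp: pmf_eq_0_set_pmf)
  finally show ?thesis
    by (simp add: nn_integral_measure_pmf)
qed

lemma prob_space_kernel:
  assumes "s \<in> dstates D"
  shows "prob_space (density S (\<lambda>c'. ennreal (dprob D s c')))"
proof
  show "emeasure (density S (\<lambda>c'. ennreal (dprob D s c'))) (space (density S (\<lambda>c'. ennreal (dprob D s c')))) = 1"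
    using nn_integral_kernel[OF assms, of "\<lambda>_. 1"] by simp
qed

text \<open>The sigma-algebra on the states is discrete, so measurability reduces to that of the
  projection to the last coordinate.\<close>

lemma kernel_measurable:
  "path_kernel D c i \<in> measurable (PiM {0..<i} (\<lambda>_. S)) (subprob_algebra S)"
proof (cases i)
  case 0
  then show ?thesis
    using start by (simp add: path_kernel_def[abs_def] space_subprob_algebra
      prob_space_imp_subprob_space prob_space_return)
next
  case (Suc j)
  have "(\<lambda>s. density S (\<lambda>c'. ennreal (dprob D s c'))) \<in> measurable S (subprob_algebra S)"
    by (simp add: space_subprob_algebra prob_space_imp_subprob_space prob_space_kernel)
  then have "(\<lambda>\<omega>. density S (\<lambda>c'. ennreal (dprob D (\<omega> j) c'))) \<in> measurable (PiM {0..<i} (\<lambda>_. S)) (subprob_algebra S)"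
    using Suc by (intro measurable_compose[OF measurable_component_singleton]) auto
  then show ?thesis
    using Suc by (simp add: path_kernel_def[abs_def])
qed

sublocale IT: Ionescu_Tulcea "path_kernel D c" "\<lambda>_. S"
proof (rule Ionescu_Tulcea.intro, goal_cases)
  case (2 i \<omega>)
  show ?case
  proof (cases i)
    case 0
    then have "path_kernel D c i \<omega> = return S c" by (simp add: path_kernel_def)
    moreover have "prob_space (return S c)" using start by (intro prob_space_return) simp
    ultimately show ?thesis by simp
  next
    case (Suc j)
    with 2 have "\<omega> j \<in> dstates D" by (simp add: space_PiM PiE_iff)
    from prob_space_kernel[OF this] show ?thesis by (simp add: path_kernel_def Suc)
  qed
qed (rule kernel_measurable)

lemma sets_C0: "sets (IT.C 0 n (\<lambda>_. undefined)) = sets (PiM {0..<n} (\<lambda>_. S))"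
  using IT.sets_C[of "\<lambda>_. undefined" 0 n] by (simp add: space_PiM)

lemma space_C0: "space (IT.C 0 n (\<lambda>_. undefined)) = {0..<n} \<rightarrow>\<^sub>E dstates D"
  by (simp add: sets_eq_imp_space_eq[OF sets_C0] space_PiM)

lemma nn_integral_C_Suc:
  assumes "g \<in> borel_measurable (PiM {0..<Suc n} (\<lambda>_. S))"
  shows "(\<integral>\<^sup>+\<omega>. g \<omega> \<partial>IT.C 0 (Suc n) (\<lambda>_. undefined)) =
    (\<integral>\<^sup>+\<omega>. (\<integral>\<^sup>+x. g (fun_upd \<omega> n x) \<partial>path_kernel D c n \<omega>) \<partial>IT.C 0 n (\<lambda>_. undefined))"
proof -
  have "(\<integral>\<^sup>+\<omega>. g \<omega> \<partial>IT.C 0 (Suc n) (\<lambda>_. undefined)) =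
     (\<integral>\<^sup>+\<omega>. g \<omega> \<partial>(IT.C 0 n (\<lambda>_. undefined) \<bind> IT.eP n))"
    by simp
  also have "\<dots> = (\<integral>\<^sup>+\<omega>. (\<integral>\<^sup>+x. g x \<partial>IT.eP n \<omega>) \<partial>IT.C 0 n (\<lambda>_. undefined))"
    using IT.measurable_eP[of n]
    by (intro nn_integral_bind[where B="PiM {0..<Suc n} (\<lambda>_. S)"] assms)
      (simp only: measurable_cong_sets[OF sets_C0 refl])
  also have "\<dots> = (\<integral>\<^sup>+\<omega>. (\<integral>\<^sup>+x. g (fun_upd \<omega> n x) \<partial>path_kernel D c n \<omega>) \<partial>IT.C 0 n (\<lambda>_. undefined))"
    by (intro nn_integral_cong IT.nn_integral_eP) (simp_all add: space_C0 space_PiM assms)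
  finally show ?thesis .
qed

lemma nn_integral_C_1:
  assumes g: "g \<in> borel_measurable (PiM {0..<1::nat} (\<lambda>_. S))"
  shows "(\<integral>\<^sup>+\<omega>. g \<omega> \<partial>IT.C 0 1 (\<lambda>_. undefined)) = g (\<lambda>i. if i = 0 then c else undefined)"
proof -
  have m: "(\<lambda>x. g (fun_upd (\<lambda>i. undefined) 0 x)) \<in> borel_measurable S"
    by simp
  have "(\<integral>\<^sup>+\<omega>. g \<omega> \<partial>IT.C 0 1 (\<lambda>_. undefined)) =
    (\<integral>\<^sup>+\<omega>. (\<integral>\<^sup>+x. g (fun_upd \<omega> 0 x) \<partial>return S c) \<partial>return (PiM {0..<0} (\<lambda>_. S)) (\<lambda>_. undefined))"
    using nn_integral_C_Suc[of g 0] g by (simp add: path_kernel_def del: IT.C.simps(2))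
  also have "\<dots> = (\<integral>\<^sup>+x. g (fun_upd (\<lambda>i. undefined) 0 x) \<partial>return S c)"
    by (subst nn_integral_return) (auto simp: space_PiM PiM_empty)
  also have "\<dots> = g (fun_upd (\<lambda>i. undefined) 0 c)"
    using start m by (subst nn_integral_return) auto
  finally show ?thesis by (simp add: fun_upd_def)
qed

text \<open>One successor accounts for the point mass at time 0; from then on each position is drawn
  from \<open>K\<close> of its predecessor.\<close>

lemma nn_integral_C_SucSuc:
  assumes g: "g \<in> borel_measurable (PiM {0..<Suc (Suc n)} (\<lambda>_. S))"
  shows "(\<integral>\<^sup>+\<omega>. g \<omega> \<partial>IT.C 0 (Suc (Suc n)) (\<lambda>_. undefined)) =
    (\<integral>\<^sup>+\<omega>. (\<integral>\<^sup>+x. g (fun_upd \<omega> (Suc n) x) \<partial>measure_pmf (K (\<omega> n))) \<partial>IT.C 0 (Suc n) (\<lambda>_. undefined))"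
proof -
  have "\<omega> n \<in> dstates D" if "\<omega> \<in> space (IT.C 0 (Suc n) (\<lambda>_. undefined))" for \<omega>
    using that unfolding space_C0 by (auto simp: PiE_iff)
  then show ?thesis
    unfolding nn_integral_C_Suc[OF g]
    by (intro nn_integral_cong) (simp add: path_kernel_def nn_integral_kernel del: IT.C.simps)
qed

text \<open>Integrating out the last position merges its avoidance probability with the test of the
  position before it, which raises \<open>k\<close> by one. Induction on \<open>n\<close>, with
  \<open>k\<close> arbitrary, thus moves all tests down to the start.\<close>

lemma nn_integral_avoid:
  "(\<integral>\<^sup>+\<omega>. of_bool (\<forall>j<n. \<not> Q (\<omega> j)) * avoid K Q k (\<omega> n) \<partial>IT.C 0 (Suc n) (\<lambda>_. undefined)) = avoid K Q (n + k) c"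
proof (induction n arbitrary: k)
  case 0
  have "(\<lambda>\<omega>. avoid K Q k (\<omega> 0)) \<in> borel_measurable (PiM {0..<1::nat} (\<lambda>_. S))"
    by (rule measurable_compose[OF measurable_component_singleton]) auto
  from nn_integral_C_1[OF this] show ?case by (simp del: IT.C.simps)
next
  case (Suc n)
  have m1: "(\<lambda>\<omega>. avoid K Q k (\<omega> (Suc n))) \<in> borel_measurable (PiM {0..<Suc (Suc n)} (\<lambda>_. S))"
    by (rule measurable_compose[OF measurable_component_singleton]) auto
  have m2: "Measurable.pred (PiM {0..<Suc (Suc n)} (\<lambda>_. S)) (\<lambda>\<omega>. Q (\<omega> j))" if "j < Suc n" for j
    using that by (intro measurable_compose[OF measurable_component_singleton[of j]]) auto
  have m3: "Measurable.pred (PiM {0..<Suc (Suc n)} (\<lambda>_. S)) (\<lambda>\<omega>. \<forall>j\<in>{..<Suc n}. \<not> Q (\<omega> j))"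
    using m2 by measurable
  have m: "(\<lambda>\<omega>. of_bool (\<forall>j<Suc n. \<not> Q (\<omega> j)) * avoid K Q k (\<omega> (Suc n))) \<in> borel_measurable (PiM {0..<Suc (Suc n)} (\<lambda>_. S))"
    using m1 m3[unfolded Ball_def lessThan_iff] by measurable
  have "(\<integral>\<^sup>+\<omega>. of_bool (\<forall>j<Suc n. \<not> Q (\<omega> j)) * avoid K Q k (\<omega> (Suc n)) \<partial>IT.C 0 (Suc (Suc n)) (\<lambda>_. undefined))
     = (\<integral>\<^sup>+\<omega>. (\<integral>\<^sup>+x. of_bool (\<forall>j<Suc n. \<not> Q (\<omega> j)) * avoid K Q k x \<partial>measure_pmf (K (\<omega> n))) \<partial>IT.C 0 (Suc n) (\<lambda>_. undefined))"
    unfolding nn_integral_C_SucSuc[OF m] by (intro nn_integral_cong) (simp del: IT.C.simps)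
  also have "\<dots> = (\<integral>\<^sup>+\<omega>. of_bool (\<forall>j<n. \<not> Q (\<omega> j)) * avoid K Q (Suc k) (\<omega> n) \<partial>IT.C 0 (Suc n) (\<lambda>_. undefined))"
    by (intro nn_integral_cong) (auto simp: nn_integral_cmult less_Suc_eq of_bool_def simp del: IT.C.simps)
  finally show ?case using Suc[of "Suc k"] by (simp del: IT.C.simps avoid.simps)
qed

text \<open>The event is a cylinder set, and the Ionescu-Tulcea limit agrees with its
  finite-dimensional marginals on cylinders.\<close>

lemma emeasure_prefix:
  assumes X: "X \<in> sets (PiM {0..<n} (\<lambda>_. S))"
  shows "emeasure (path_measure D c) {\<pi> \<in> space (path_measure D c). restrict \<pi> {0..<n} \<in> X} =
    emeasure (IT.C 0 n (\<lambda>_. undefined)) X"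
proof -
  have "{\<pi> \<in> space (path_measure D c). restrict \<pi> {0..<n} \<in> X} = prod_emb UNIV (\<lambda>_. S) {0..<n} X"
    by (auto simp: path_measure_def prod_emb_def space_PiM)
  moreover have "prod_emb {0..<n} (\<lambda>_. S) {0..<n} X = X"
    using sets.sets_into_space[OF X] by (intro prod_emb_id) (simp add: space_PiM)
  ultimately show ?thesis
    using IT.lim[of "{0..<n}" X] X
    by (simp add: path_measure_def IT.emeasure_CI[OF order_refl X])
qed

lemma space_path_measure: "space (path_measure D c) = UNIV \<rightarrow>\<^sub>E dstates D"
  by (simp add: path_measure_def space_PiM)

lemma prob_space_path_measure: "prob_space (path_measure D c)"
proof
  have "emeasure (IT.C 0 0 (\<lambda>_. undefined)) (space (PiM {0..<0} (\<lambda>_. S))) = 1"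
    by (simp add: PiM_empty)
  then show "emeasure (path_measure D c) (space (path_measure D c)) = 1"
    using emeasure_prefix[OF sets.top, of 0] by (simp add: PiM_empty restrict_def)
qed

lemma coordinate_measurable:
  "{\<pi> \<in> space (path_measure D c). Q (\<pi> j)} \<in> sets (path_measure D c)"
proof -
  have "Measurable.pred (PiM UNIV (\<lambda>_. S)) (\<lambda>\<omega>. Q (\<omega> j))"
    by (intro measurable_compose[OF measurable_component_singleton[of j]]) auto
  then show ?thesis
    by (simp add: pred_def path_measure_def)
qed

lemma emeasure_avoid:
  "emeasure (path_measure D c) {\<pi> \<in> space (path_measure D c). \<forall>j\<le>n. \<not> Q (\<pi> j)} = avoid K Q n c"
proof -
  let ?X = "{\<omega> \<in> space (PiM {0..<Suc n} (\<lambda>_. S)). \<forall>j<Suc n. \<not> Q (\<omega> j)}"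
  have m2: "Measurable.pred (PiM {0..<Suc n} (\<lambda>_. S)) (\<lambda>\<omega>. Q (\<omega> j))" if "j < Suc n" for j
    using that by (intro measurable_compose[OF measurable_component_singleton[of j]]) auto
  have m3: "Measurable.pred (PiM {0..<Suc n} (\<lambda>_. S)) (\<lambda>\<omega>. \<forall>j\<in>{..<Suc n}. \<not> Q (\<omega> j))"
    using m2 by measurable
  then have X: "?X \<in> sets (PiM {0..<Suc n} (\<lambda>_. S))"
    unfolding pred_def Ball_def lessThan_iff .
  have "{\<pi> \<in> space (path_measure D c). \<forall>j\<le>n. \<not> Q (\<pi> j)} =
      {\<pi> \<in> space (path_measure D c). restrict \<pi> {0..<Suc n} \<in> ?X}"
    by (rule Collect_cong) (auto simp: space_path_measure space_PiM PiE_iff less_Suc_eq_le)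
  then have "emeasure (path_measure D c) {\<pi> \<in> space (path_measure D c). \<forall>j\<le>n. \<not> Q (\<pi> j)} =
      emeasure (IT.C 0 (Suc n) (\<lambda>_. undefined)) ?X"
    by (simp only: emeasure_prefix[OF X])
  also have "\<dots> = (\<integral>\<^sup>+\<omega>. indicator ?X \<omega> \<partial>IT.C 0 (Suc n) (\<lambda>_. undefined))"
    by (rule nn_integral_indicator[symmetric]) (simp only: sets_C0 X)
  also have "\<dots> = (\<integral>\<^sup>+\<omega>. of_bool (\<forall>j<n. \<not> Q (\<omega> j)) * avoid K Q 0 (\<omega> n) \<partial>IT.C 0 (Suc n) (\<lambda>_. undefined))"
    by (intro nn_integral_cong) (auto simp: space_C0 space_PiM indicator_def less_Suc_eq simp del: IT.C.simps)
  finally show ?thesis by (simp only: nn_integral_avoid) simp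
qed

lemma measure_eventually:
  "measure (path_measure D c) {\<pi> \<in> space (path_measure D c). \<exists>j. Q (\<pi> j)} = reach K Q c"
proof -
  interpret M: prob_space "path_measure D c" by (rule prob_space_path_measure)
  let ?A = "\<lambda>n. {\<pi> \<in> space (path_measure D c). \<forall>j\<le>n. \<not> Q (\<pi> j)}"
  have A: "?A n \<in> sets (path_measure D c)" for n
  proof -
    have "{\<pi> \<in> space (path_measure D c). \<forall>j\<in>{..n}. \<not> Q (\<pi> j)} \<in> sets (path_measure D c)"
      by (rule sets.sets_Collect_finite_All[where P = "\<lambda>j \<pi>. \<not> Q (\<pi> j)"])
        (rule coordinate_measurable[of "\<lambda>s. \<not> Q s"], rule finite_atMost)
    then show ?thesis unfolding Ball_def atMost_iff .
  qed
  \<comment> \<open>Never visiting \<open>Q\<close> is the decreasing intersection of the events of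
    avoiding it up to time \<open>n\<close>; continuity from above gives its measure.\<close>
  have "(INF n. avoid K Q n c) = (INF n. emeasure (path_measure D c) (?A n))"
    by (simp add: emeasure_avoid)
  also have "\<dots> = emeasure (path_measure D c) (\<Inter>n. ?A n)"
  proof (rule INF_emeasure_decseq)
    show "range ?A \<subseteq> sets (path_measure D c)"
      using A by (rule image_subsetI)
    show "decseq ?A"
      unfolding decseq_def by (intro allI impI Collect_mono) (meson le_trans)
  qed (simp add: emeasure_avoid neq_top_trans[OF ennreal_one_neq_top avoid_le_1])
  also have "(\<Inter>n. ?A n) = space (path_measure D c) - {\<pi> \<in> space (path_measure D c). \<exists>j. Q (\<pi> j)}"
    by auto
  finally have "enn2real (INF n. avoid K Q n c) =
      measure (path_measure D c) (space (path_measure D c) - {\<pi> \<in> space (path_measure D c). \<exists>j. Q (\<pi> j)})"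
    by (simp add: measure_def)
  also have "\<dots> = 1 - measure (path_measure D c) {\<pi> \<in> space (path_measure D c). \<exists>j. Q (\<pi> j)}"
    using coordinate_measurable by (intro M.prob_compl sets.sets_Collect_countable_Ex)
  finally show ?thesis by (simp add: reach_def)
qed

text \<open>Only the marginal on positions 0 and 1 matters: integrating out position 1 leaves a
  function of position 0, which is fixed to \<open>c\<close>.\<close>

lemma measure_next:
  "measure (path_measure D c) {\<pi> \<in> space (path_measure D c). Q (\<pi> 1)} = measure_pmf.prob (K c) {s. Q s}"
proof -
  let ?X = "{\<omega> \<in> space (PiM {0..<2::nat} (\<lambda>_. S)). Q (\<omega> 1)}"
  have "Measurable.pred (PiM {0..<2::nat} (\<lambda>_. S)) (\<lambda>\<omega>. Q (\<omega> 1))"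
    by (intro measurable_compose[OF measurable_component_singleton[of 1]]) auto
  then have X: "?X \<in> sets (PiM {0..<2::nat} (\<lambda>_. S))"
    unfolding pred_def .
  have g: "indicator ?X \<in> borel_measurable (PiM {0..<Suc (Suc 0)} (\<lambda>_. S))"
    using borel_measurable_indicator[OF X] by (simp only: numeral_2_eq_2)
  have g1: "(\<lambda>\<omega>. emeasure (measure_pmf (K (\<omega> 0))) {s. Q s}) \<in> borel_measurable (PiM {0..<1::nat} (\<lambda>_. S))"
    by (rule measurable_compose[OF measurable_component_singleton[of 0]]) auto
  have "{\<pi> \<in> space (path_measure D c). Q (\<pi> 1)} =
      {\<pi> \<in> space (path_measure D c). restrict \<pi> {0..<2} \<in> ?X}"
    by (rule Collect_cong) (auto simp: space_path_measure space_PiM PiE_iff)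
  then have "emeasure (path_measure D c) {\<pi> \<in> space (path_measure D c). Q (\<pi> 1)} =
      emeasure (IT.C 0 2 (\<lambda>_. undefined)) ?X"
    by (simp only: emeasure_prefix[OF X])
  also have "\<dots> = (\<integral>\<^sup>+\<omega>. indicator ?X \<omega> \<partial>IT.C 0 (Suc (Suc 0)) (\<lambda>_. undefined))"
    unfolding numeral_2_eq_2
    by (rule nn_integral_indicator[symmetric]) (simp only: sets_C0 X[unfolded numeral_2_eq_2])
  also have "\<dots> = (\<integral>\<^sup>+\<omega>. emeasure (measure_pmf (K (\<omega> 0))) {s. Q s} \<partial>IT.C 0 (Suc 0) (\<lambda>_. undefined))"
    unfolding nn_integral_C_SucSuc[OF g]
  proof (intro nn_integral_cong)
    fix \<omega> assume "\<omega> \<in> space (IT.C 0 (Suc 0) (\<lambda>_. undefined))"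
    then have \<omega>: "\<omega> \<in> {0..<Suc 0} \<rightarrow>\<^sub>E dstates D"
      unfolding space_C0 .
    then have "set_pmf (K (\<omega> 0)) \<subseteq> dstates D"
      by (intro closed) auto
    moreover have "fun_upd \<omega> (Suc 0) x \<in> ?X \<longleftrightarrow> Q x" if "x \<in> dstates D" for x
      using that \<omega> by (auto simp: space_PiM PiE_iff extensional_def less_Suc_eq numeral_2_eq_2)
    ultimately have "(\<integral>\<^sup>+x. indicator ?X (fun_upd \<omega> (Suc 0) x) \<partial>measure_pmf (K (\<omega> 0))) =
        (\<integral>\<^sup>+x. indicator {s. Q s} x \<partial>measure_pmf (K (\<omega> 0)))"
      by (intro nn_integral_cong_AE) (auto simp: AE_measure_pmf_iff indicator_def)
    then show "(\<integral>\<^sup>+x. indicator ?X (fun_upd \<omega> (Suc 0) x) \<partial>measure_pmf (K (\<omega> 0))) =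
        emeasure (measure_pmf (K (\<omega> 0))) {s. Q s}"
      by simp
  qed
  also have "\<dots> = emeasure (measure_pmf (K c)) {s. Q s}"
    by (subst nn_integral_C_1[OF g1, unfolded One_nat_def]) simp
  finally show ?thesis by (simp add: measure_def)
qed

end

section \<open>First-step analysis of reachability probabilities\<close>

lemma avoid_antimono: "decseq (avoid K Q)"
proof (rule decseq_SucI, rule le_funI)
  show "avoid K Q (Suc n) c \<le> avoid K Q n c" for n c
  proof (induction n arbitrary: c)
    case 0
    show ?case using avoid_le_1[of K Q 1 c] by (auto simp: of_bool_def)
  next
    case (Suc n)
    show ?case
      unfolding avoid.simps(2)[of K Q "Suc n"] avoid.simps(2)[of K Q n c]
      by (intro mult_left_mono nn_integral_mono Suc) auto
  qed
qed

text \<open>The recursion passes to the limit by monotone convergence. For decreasing sequences this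
  needs a finite integral, which the bound 1 provides. Dropping the first term does not change the
  infimum of a decreasing sequence.\<close>

lemma avoid_INF:
  "(INF n. avoid K Q n c) = of_bool (\<not> Q c) * (\<integral>\<^sup>+c'. (INF n. avoid K Q n c') \<partial>measure_pmf (K c))"
proof -
  have fin: "(\<integral>\<^sup>+c'. avoid K Q 0 c' \<partial>measure_pmf (K c)) < \<infinity>"
    by (rule le_less_trans[OF nn_integral_mono[of _ _ "\<lambda>_. 1"]]) (auto simp: avoid_le_1)
  have dec: "decseq (\<lambda>n. avoid K Q n c)" for c
    by (intro antimonoI le_funD[OF antimonoD[OF avoid_antimono]])
  have "(INF n. avoid K Q n c) = (INF n. avoid K Q (n + 1) c)"
  proof (rule antisym)
    show "(INF n. avoid K Q n c) \<le> (INF n. avoid K Q (n + 1) c)"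
      by (rule INF_mono) blast
    show "(INF n. avoid K Q (n + 1) c) \<le> (INF n. avoid K Q n c)"
      by (rule INF_mono) (use antimonoD[OF dec] le_add1 in blast)
  qed
  also have "\<dots> = (INF n. of_bool (\<not> Q c) * (\<integral>\<^sup>+c'. avoid K Q n c' \<partial>measure_pmf (K c)))"
    by simp
  also have "\<dots> = of_bool (\<not> Q c) * (INF n. (\<integral>\<^sup>+c'. avoid K Q n c' \<partial>measure_pmf (K c)))"
    by (cases "Q c") auto
  also have "(INF n. (\<integral>\<^sup>+c'. avoid K Q n c' \<partial>measure_pmf (K c))) =
      (\<integral>\<^sup>+c'. (INF n. avoid K Q n c') \<partial>measure_pmf (K c))"
    by (rule nn_integral_monotone_convergence_INF_decseq[OF avoid_antimono _ fin, symmetric]) simp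
  finally show ?thesis .
qed

lemma INF_avoid_le_1: "(INF n. avoid K Q n c) \<le> 1"
  by (rule INF_lower2[of 0]) (auto simp: avoid_le_1)

lemma ennreal_INF_avoid: "(INF n. avoid K Q n c) = ennreal (1 - reach K Q c)"
  by (simp add: reach_def ennreal_enn2real[OF le_less_trans[OF INF_avoid_le_1 ennreal_one_less_top]])

lemma reach_le_1: "reach K Q c \<le> 1"
  by (simp add: reach_def)

lemma reach_nonneg: "0 \<le> reach K Q c"
  using INF_avoid_le_1[of K Q c] by (simp add: reach_def enn2real_leI)

lemma integrable_reach: "integrable (measure_pmf p) (reach K Q)"
  by (rule measure_pmf.integrable_const_bound[where B=1]) (auto simp: reach_nonneg reach_le_1)

text \<open>The limit recursion for avoiding \<open>Q\<close>, complemented; all functions lie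
  between 0 and 1, so the nonnegative integral turns into an expectation.\<close>

lemma reach_step:
  "reach K Q c = (if Q c then 1 else measure_pmf.expectation (K c) (reach K Q))"
proof (cases "Q c")
  case True
  then show ?thesis by (subst reach_def, subst avoid_INF) simp
next
  case False
  then have "ennreal (1 - reach K Q c) = (\<integral>\<^sup>+c'. ennreal (1 - reach K Q c') \<partial>measure_pmf (K c))"
    using avoid_INF[of K Q c] by (simp add: ennreal_INF_avoid)
  also have "\<dots> = ennreal (measure_pmf.expectation (K c) (\<lambda>c'. 1 - reach K Q c'))"
    by (intro nn_integral_eq_integral Bochner_Integration.integrable_diff integrable_reach)
      (simp_all add: reach_le_1)
  finally have "1 - reach K Q c = measure_pmf.expectation (K c) (\<lambda>c'. 1 - reach K Q c')"
    by (subst (asm) ennreal_inj) (auto intro!: integral_nonneg simp: reach_le_1)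
  also have "\<dots> = 1 - measure_pmf.expectation (K c) (reach K Q)"
    by (simp add: Bochner_Integration.integral_diff integrable_reach)
  finally show ?thesis using False by simp
qed

text \<open>The chain cannot leave the closed set \<open>I\<close>, so every avoidance probability
  on it is 1.\<close>

lemma reach_eq_0:
  assumes "c \<in> I" and "\<And>s. s \<in> I \<Longrightarrow> \<not> Q s \<and> set_pmf (K s) \<subseteq> I"
  shows "reach K Q c = 0"
proof -
  have "avoid K Q n s = 1" if "s \<in> I" for n s
    using that
  proof (induction n arbitrary: s)
    case (Suc n)
    then have "(\<integral>\<^sup>+c'. avoid K Q n c' \<partial>measure_pmf (K s)) = (\<integral>\<^sup>+c'. 1 \<partial>measure_pmf (K s))"
      using assms(2) by (intro nn_integral_cong_AE) (auto simp: AE_measure_pmf_iff)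
    then show ?case using Suc assms(2) by auto
  qed (use assms in auto)
  then show ?thesis using assms(1) by (simp add: reach_def)
qed

text \<open>A nonnegative function with expectation 0 vanishes on the whole support. Hence the
  demand that violations have probability 0 is inherited by every possible successor; this lets one
  formula control all later visits.\<close>

lemma reach_eq_0D:
  assumes "reach K Q c = 0"
  shows "\<not> Q c" and "s \<in> set_pmf (K c) \<Longrightarrow> reach K Q s = 0"
proof -
  show nQ: "\<not> Q c" using assms by (subst (asm) reach_step) (auto split: if_splits)
  then have "measure_pmf.expectation (K c) (reach K Q) = 0"
    using assms reach_step[of K Q c] by simp
  then have "AE s in measure_pmf (K c). reach K Q s = 0"
    using integrable_reach by (subst (asm) integral_nonneg_eq_0_iff_AE) (auto simp: reach_nonneg)
  then show "s \<in> set_pmf (K c) \<Longrightarrow> reach K Q s = 0"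
    by (simp add: AE_measure_pmf_iff)
qed

lemma avoid_cong:
  assumes "\<And>s. s \<in> I \<Longrightarrow> Q s = Q' s \<and> set_pmf (K s) \<subseteq> I" "s \<in> I"
  shows "avoid K Q n s = avoid K Q' n s"
  using assms(2)
proof (induction n arbitrary: s)
  case (Suc n)
  then have "(\<integral>\<^sup>+c'. avoid K Q n c' \<partial>measure_pmf (K s)) = (\<integral>\<^sup>+c'. avoid K Q' n c' \<partial>measure_pmf (K s))"
    using assms(1) by (intro nn_integral_cong_AE) (auto simp: AE_measure_pmf_iff)
  then show ?case using Suc.prems assms(1) by simp
qed (use assms in simp)

text \<open>Used to replace the satisfaction of a formula by an explicit condition, where the two
  agree only on proper configurations.\<close>

lemma reach_cong:
  assumes "\<And>s. s \<in> I \<Longrightarrow> Q s = Q' s \<and> set_pmf (K s) \<subseteq> I" "s \<in> I"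
  shows "reach K Q s = reach K Q' s"
  using avoid_cong[of I Q Q' K s] assms by (simp add: reach_def)

section \<open>A game with one player\<close>

text \<open>Action \<open>a\<close> leads from state 0 to state \<open>a\<close>, so there a
  strategy chooses the next state directly; in states 1 and 2 all actions share one distribution.
  Atom 0 marks having left state 0, atom 1 marks acceptance.\<close>

definition game :: "nat \<Rightarrow> fin_game" where
  "game p = FinGame 1 [1, 1, 1] 3
     [[[1, 0, 0], [0, 1, 0], [0, 0, 1]],
      replicate 3 [0, 1 / of_nat (p + 1), of_nat p / of_nat (p + 1)],
      replicate 3 [0, 0, 1]]
     2 [{||}, {|0, 1|}, {|0|}]"

abbreviation "arena p \<equiv> game_of (game p)"

lemma lessThan_3: "{..<3::nat} = {0, 1, 2}"
  by auto

lemma arena_simps [simp]: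
  "num_agents (arena p) = 1" "states (arena p) = {..<3}" "actions (arena p) = {..<3}"
  "aprops (arena p) = {..<2}" "agents (arena p) = {1}"
  "label (arena p) 0 = {}" "label (arena p) (Suc 0) = {0, 1}" "label (arena p) 2 = {0}"
  by (auto simp: game_of_def game_def agents_def)

lemma owner_arena: "s < 3 \<Longrightarrow> owner (arena p) s = 1"
  by (auto simp: game_of_def game_def less_Suc_eq numeral_3_eq_3)

lemma states_of_arena [simp]: "states_of (arena p) {Suc 0} = {..<3}"
  by (auto simp: states_of_def owner_arena)

lemma trans_arena:
  assumes "s < 3" "a < 3" "s' < 3"
  shows "trans (arena p) s a s' =
    (if s = 0 then of_bool (a = s')
     else if s = 1 then (if s' = 0 then 0 else if s' = 1 then 1 / (real p + 1) else real p / (real p + 1))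
     else of_bool (s' = 2))"
  using assms by (auto simp: game_of_def game_def less_Suc_eq numeral_3_eq_3 numeral_2_eq_2 of_rat_divide of_rat_add)

lemma enabled_arena [simp]:
  assumes "s < 3" shows "enabled (arena p) s = {..<3}"
proof -
  have "(trans (arena p) s a has_sum 1) {..<3}" if "a < 3" for a
    using assms that by (intro has_sum_finiteI) (auto simp: trans_arena lessThan_3 add_divide_distrib[symmetric])
  then show ?thesis by (auto simp: enabled_def)
qed

lemma is_fin_game_game: "is_fin_game (game p)"
proof -
  have "label (arena p) s \<subseteq> {..<2}" if "s < 3" for s
    using that by (auto simp: game_of_def game_def less_Suc_eq numeral_3_eq_3)
  then have "is_tsg (arena p)"
    by (auto simp: is_tsg_def owner_arena trans_arena)
  then show ?thesis
    by (simp add: is_fin_game_def) (simp add: game_def)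
qed

lemma is_strategy_arena:
  "is_strategy (arena p) {Suc 0} \<alpha> \<longleftrightarrow>
     (\<forall>s<3. init \<alpha> s \<in> modes \<alpha>) \<and> (\<forall>q\<in>modes \<alpha>. \<forall>s<3. mode \<alpha> q s \<in> modes \<alpha>) \<and>
     (\<forall>q\<in>modes \<alpha>. \<forall>s<3. set_pmf (act \<alpha> q s) \<subseteq> {..<3})"
proof -
  have "(\<forall>s<3. init \<alpha> s \<in> modes \<alpha>) \<Longrightarrow> modes \<alpha> \<noteq> {}"
    by (metis empty_iff zero_less_numeral)
  moreover have "(\<forall>s\<in>{..<3}. set_pmf (act \<alpha> q s) \<subseteq> enabled (arena p) s) \<longleftrightarrow>
      (\<forall>s<3. set_pmf (act \<alpha> q s) \<subseteq> {..<3})" for q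
    by (metis enabled_arena lessThan_iff)
  ultimately show ?thesis by (simp add: is_strategy_def) blast
qed

lemma joint_at_arena [simp]: "joint_at (arena p) m x = the (m x 1)"
  by (simp add: joint_at_def joint_def)

lemma pmf_if_bernoulli:
  assumes "0 \<le> r" "r \<le> 1" "a \<noteq> b"
  shows "pmf (map_pmf (\<lambda>c. if c then a else b) (bernoulli_pmf r)) x =
    (if x = a then r else if x = b then 1 - r else 0)"
proof -
  have "(\<lambda>c. if c then a else b) -` {x} = (if x = a then {True} else if x = b then {False} else {})"
    using assms(3) by (auto split: if_splits)
  then show ?thesis
    using assms by (simp add: pmf_map measure_pmf_single)
qed

text \<open>In state 1 the action is irrelevant, and state 2 is absorbing.\<close>

definition move :: "nat \<Rightarrow> strategy \<Rightarrow> nat \<Rightarrow> state \<Rightarrow> state pmf" where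
  "move p \<alpha> q s =
     (if s = 0 then act \<alpha> q 0
      else if s = 1 then map_pmf (\<lambda>b. if b then 1 else 2) (bernoulli_pmf (1 / (real p + 1)))
      else return_pmf 2)"

definition step :: "nat \<Rightarrow> strategy \<Rightarrow> state \<times> nat \<Rightarrow> (state \<times> nat) pmf" where
  "step p \<alpha> z = map_pmf (\<lambda>s'. (s', mode \<alpha> (snd z) (fst z))) (move p \<alpha> (snd z) (fst z))"

text \<open>In state 0 the sum over the actions has a single nonzero term; in states 1 and 2 the
  transition probability is a constant factor and the action probabilities sum to 1.\<close>

lemma pmf_move:
  assumes "set_pmf (act \<alpha> q s) \<subseteq> {..<3}" "s < 3" "s' < 3"
  shows "(\<Sum>a<3. trans (arena p) s a s' * pmf (act \<alpha> q s) a) = pmf (move p \<alpha> q s) s'"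
proof -
  have sum1: "(\<Sum>a<3. pmf (act \<alpha> q s) a) = 1"
    using assms(1) by (intro sum_pmf_eq_1) auto
  consider "s = 0" | "s = 1" | "s = 2" using assms(2) by linarith
  then show ?thesis
  proof cases
    case 1
    have "(\<Sum>a<3. trans (arena p) s a s' * pmf (act \<alpha> q s) a) = (\<Sum>a<3. if a = s' then pmf (act \<alpha> q s) a else 0)"
      using 1 assms by (intro sum.cong) (auto simp: trans_arena)
    then show ?thesis using 1 assms(3) by (simp add: move_def)
  next
    case 2
    have "(\<Sum>a<3. trans (arena p) s a s' * pmf (act \<alpha> q s) a) =
        (\<Sum>a<3. (if s' = 0 then 0 else if s' = 1 then 1 / (real p + 1) else real p / (real p + 1)) * pmf (act \<alpha> q s) a)"
      using 2 assms by (intro sum.cong) (auto simp: trans_arena)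
    also have "\<dots> = (if s' = 0 then 0 else if s' = 1 then 1 / (real p + 1) else real p / (real p + 1))"
      by (simp only: sum_distrib_left[symmetric] sum1 mult_1_right)
    also have "\<dots> = pmf (move p \<alpha> q s) s'"
      using 2 assms(3) by (simp add: move_def pmf_if_bernoulli divide_le_eq_1 field_simps)
    finally show ?thesis .
  next
    case 3
    have "(\<Sum>a<3. trans (arena p) s a s' * pmf (act \<alpha> q s) a) = (\<Sum>a<3. of_bool (s' = 2) * pmf (act \<alpha> q s) a)"
      using 3 assms by (intro sum.cong) (auto simp: trans_arena)
    also have "\<dots> = pmf (move p \<alpha> q s) s'"
      unfolding sum_distrib_left[symmetric] sum1 using 3 by (simp add: move_def indicator_def)
    finally show ?thesis .
  qed
qed

lemma set_move: "s < 3 \<Longrightarrow> set_pmf (act \<alpha> q s) \<subseteq> {..<3} \<Longrightarrow> set_pmf (move p \<alpha> q s) \<subseteq> {..<3}"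
  by (auto simp: move_def split: if_splits)

lemma dprob_induced_arena:
  assumes "is_strategy (arena p) {1} \<alpha>" "z \<in> {..<3} \<times> modes \<alpha>" "z' \<in> {..<3} \<times> modes \<alpha>"
  shows "dprob (induced (arena p) \<alpha>) z z' = pmf (step p \<alpha> z) z'"
proof -
  obtain s q s' q' where z: "z = (s, q)" "z' = (s', q')" by (meson surj_pair)
  have "pmf (step p \<alpha> z) z' = (if q' = mode \<alpha> q s then pmf (move p \<alpha> q s) s' else 0)"
  proof (cases "q' = mode \<alpha> q s")
    case True
    have "inj (\<lambda>s'. (s', mode \<alpha> q s))" by (simp add: inj_def)
    from pmf_map_inj'[OF this] True show ?thesis by (simp add: step_def z)
  qed (auto simp: step_def z pmf_eq_0_set_pmf)
  then show ?thesis
    using assms by (simp add: induced_def z pmf_move is_strategy_arena)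
qed

section \<open>Several strategies running in parallel\<close>

definition kern :: "nat \<Rightarrow> svar set \<Rightarrow> (svar \<Rightarrow> strategy) \<Rightarrow> (svar \<Rightarrow> state \<times> nat) \<Rightarrow> (svar \<Rightarrow> state \<times> nat) pmf" where
  "kern p V A c = Pi_pmf V undefined (\<lambda>x. step p (A x) (c x))"

definition configs :: "svar set \<Rightarrow> (svar \<Rightarrow> strategy) \<Rightarrow> (svar \<Rightarrow> state \<times> nat) set" where
  "configs V A = (\<Pi>\<^sub>E x\<in>V. {..<3} \<times> modes (A x))"

lemma set_kern:
  assumes "finite V" "\<And>x. x \<in> V \<Longrightarrow> is_strategy (arena p) {1} (A x)" "c \<in> configs V A"
  shows "set_pmf (kern p V A c) \<subseteq> configs V A"
proof -
  have "set_pmf (step p (A x) (c x)) \<subseteq> {..<3} \<times> modes (A x)" if "x \<in> V" for x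
  proof -
    have c: "fst (c x) < 3" "snd (c x) \<in> modes (A x)"
      using assms(3) that by (auto simp: configs_def PiE_iff mem_Times_iff)
    with assms(2)[OF that] have "set_pmf (act (A x) (snd (c x)) (fst (c x))) \<subseteq> {..<3}" "mode (A x) (snd (c x)) (fst (c x)) \<in> modes (A x)"
      by (auto simp: is_strategy_arena)
    with set_move[OF c(1) this(1)] show ?thesis by (auto simp: step_def)
  qed
  then show ?thesis
    using assms(1) by (auto simp: kern_def set_Pi_pmf PiE_dflt_def configs_def PiE_iff extensional_def)
qed

lemma pmf_chain_arena:
  assumes "finite V" "\<And>x. x \<in> V \<Longrightarrow> is_strategy (arena p) {1} (A x)" "c \<in> configs V A"
  shows "pmf_chain (product_dtmc V (\<lambda>x. induced (arena p) (A x))) (kern p V A) c"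
proof
  let ?D = "product_dtmc V (\<lambda>x. induced (arena p) (A x))"
  have ds: "dstates ?D = configs V A"
    by (simp add: product_dtmc_def induced_def configs_def)
  show "countable (dstates ?D)"
    unfolding ds configs_def by (intro countable_PiE assms(1)) simp
  show "c \<in> dstates ?D" using assms(3) ds by simp
  show "set_pmf (kern p V A s) \<subseteq> dstates ?D" if "s \<in> dstates ?D" for s
    using set_kern[of V p A s] assms(1,2) that unfolding ds by blast
  show "dprob ?D s s' = pmf (kern p V A s) s'" if "s \<in> dstates ?D" "s' \<in> dstates ?D" for s s'
  proof -
    \<comment> \<open>Outside \<open>V\<close> extensional functions take the value
      \<open>undefined\<close>, which is also the default value of the product distribution in
      \<open>kern\<close>.\<close>
    have "\<forall>x. x \<notin> V \<longrightarrow> s' x = undefined"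
      using that(2) by (auto simp: ds configs_def PiE_iff extensional_def)
    then have "pmf (kern p V A s) s' = (\<Prod>x\<in>V. pmf (step p (A x) (s x)) (s' x))"
      using assms(1) by (simp add: kern_def pmf_Pi)
    also have "\<dots> = (\<Prod>x\<in>V. dprob (induced (arena p) (A x)) (s x) (s' x))"
      using that assms(2) unfolding ds configs_def
      by (intro prod.cong dprob_induced_arena[symmetric]) (auto simp: PiE_iff)
    finally show ?thesis by (simp add: product_dtmc_def)
  qed
qed

section \<open>Values of the probability operators along paths\<close>

abbreviation strats :: "strategy_map \<Rightarrow> svar \<Rightarrow> strategy" where
  "strats m \<equiv> \<lambda>x. the (m x (Suc 0))"

definition start :: "strategy_map \<Rightarrow> valuation \<Rightarrow> svar \<Rightarrow> state \<times> nat" where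
  "start m v = (\<lambda>x\<in>dom v. (the (v x), init (strats m x) (the (v x))))"

text \<open>These are the contexts in which a probability operator gets evaluated: every variable in
  scope has a state and a strategy.\<close>

definition admissible :: "nat \<Rightarrow> svar set \<Rightarrow> strategy_map \<Rightarrow> valuation \<Rightarrow> bool" where
  "admissible p V m v \<longleftrightarrow>
     finite V \<and> dom v = V \<and> (\<forall>x\<in>V. the (v x) < 3 \<and> is_strategy (arena p) {1} (strats m x))"

lemma start_in_configs: "admissible p V m v \<Longrightarrow> start m v \<in> configs V (strats m)"
  by (auto simp: admissible_def start_def configs_def is_strategy_arena)

lemma context_paths_arena:
  assumes "admissible p V m v"
  shows "context_paths (arena p) m v = path_measure (product_dtmc V (\<lambda>x. induced (arena p) (strats m x))) (start m v)"
  using assms by (simp add: context_paths_def start_def admissible_def)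

lemma pmf_chain_admissible:
  assumes "admissible p V m v"
  shows "pmf_chain (product_dtmc V (\<lambda>x. induced (arena p) (strats m x))) (kern p V (strats m)) (start m v)"
  using assms by (intro pmf_chain_arena start_in_configs) (auto simp: admissible_def)

lemma val_Next:
  assumes "admissible p V m v"
  shows "val (arena p) m v (Prob (Next \<theta>)) =
    measure_pmf.prob (kern p V (strats m) (start m v))
      {c. sat (arena p) (map_at (arena p) m v c) (val_at v c) \<theta>}"
  using pmf_chain.measure_next[OF pmf_chain_admissible[OF assms]]
  by (simp add: context_paths_arena[OF assms])

lemma val_Until_TT:
  assumes "admissible p V m v"
  shows "val (arena p) m v (Prob (Until TT \<theta>)) =
    reach (kern p V (strats m)) (\<lambda>c. sat (arena p) (map_at (arena p) m v c) (val_at v c) \<theta>) (start m v)"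
  using pmf_chain.measure_eventually[OF pmf_chain_admissible[OF assms]]
  by (simp add: context_paths_arena[OF assms])

lemma strats_map_at:
  assumes "admissible p V m v" "x \<in> V"
  shows "strats (map_at (arena p) m v c) x =
    restrict_strategy (arena p) 1 (strats m x)\<lparr>init := \<lambda>_. snd (c x)\<rparr>"
  using assms by (simp add: map_at_def admissible_def)

text \<open>Moving along a path changes only the initial modes, and the restriction to agent 1 keeps
  the choices in state 0, the only ones that \<open>move\<close> consults.\<close>

lemma kern_map_at:
  assumes "admissible p V m v"
  shows "kern p V (strats (map_at (arena p) m v c)) = kern p V (strats m)"
proof
  fix c'
  have "step p (strats (map_at (arena p) m v c) x) = step p (strats m x)" if "x \<in> V" for x
    unfolding strats_map_at[OF assms that]
    by (auto simp: step_def[abs_def] move_def restrict_strategy_def fun_eq_iff)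
  then show "kern p V (strats (map_at (arena p) m v c)) c' = kern p V (strats m) c'"
    using assms unfolding kern_def by (intro Pi_pmf_cong) (auto simp: admissible_def)
qed

text \<open>Together with \<open>kern_map_at\<close>: a probability operator nested in another one
  and evaluated at \<open>c\<close> speaks of the same chain, started in \<open>c\<close>.\<close>

lemma start_map_at:
  assumes "admissible p V m v" "c \<in> configs V (strats m)"
  shows "start (map_at (arena p) m v c) (val_at v c) = c"
proof
  fix x
  have "dom (val_at v c) = V"
    using assms(1) by (auto simp: admissible_def val_at_def dom_def)
  then show "start (map_at (arena p) m v c) (val_at v c) x = c x"
    using assms strats_map_at[OF assms(1), of x c]
    by (auto simp: start_def val_at_def configs_def PiE_iff extensional_def admissible_def)
qed

lemma admissible_map_at:
  assumes "admissible p V m v" "c \<in> configs V (strats m)"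
  shows "admissible p V (map_at (arena p) m v c) (val_at v c)"
proof -
  have dom: "dom (val_at v c) = V" and "finite V"
    using assms(1) by (auto simp: admissible_def val_at_def dom_def)
  moreover have "the (val_at v c x) < 3 \<and> is_strategy (arena p) {1} (strats (map_at (arena p) m v c) x)" if "x \<in> V" for x
  proof -
    have c: "fst (c x) < 3" "snd (c x) \<in> modes (strats m x)"
      using assms(2) that by (auto simp: configs_def PiE_iff mem_Times_iff)
    moreover have "is_strategy (arena p) {1} (strats m x)"
      using assms(1) that by (simp add: admissible_def)
    ultimately show ?thesis
      using assms(1) that unfolding strats_map_at[OF assms(1) that]
      by (simp add: is_strategy_arena restrict_strategy_def val_at_def admissible_def)
  qed
  ultimately show ?thesis by (simp add: admissible_def)
qed

lemma sat_Atom_at: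
  assumes "admissible p V m v" "x \<in> V"
  shows "sat (arena p) (map_at (arena p) m v c) (val_at v c) (Atom a x) \<longleftrightarrow> a \<in> label (arena p) (fst (c x))"
  using assms by (simp add: val_at_def admissible_def)

section \<open>Strategies as natural numbers\<close>

text \<open>The components move independently, so the marginal at \<open>x\<close> is the step of
  the strategy of \<open>x\<close> alone.\<close>

lemma prob_kern:
  assumes "finite V" "x \<in> V"
  shows "measure_pmf.prob (kern p V A c) {c'. P (fst (c' x))} =
    measure_pmf.prob (move p (A x) (snd (c x)) (fst (c x))) {s. P s}"
proof -
  have "measure_pmf.prob (kern p V A c) {c'. P (fst (c' x))} =
      measure_pmf.prob (map_pmf (\<lambda>c'. c' x) (kern p V A c)) {z. P (fst z)}"
    unfolding measure_map_pmf vimage_def mem_Collect_eq ..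
  also have "map_pmf (\<lambda>c'. c' x) (kern p V A c) = step p (A x) (c x)"
    unfolding kern_def Pi_pmf_component[OF assms(1)] using assms(2) by (rule if_P)
  finally show ?thesis
    unfolding step_def measure_map_pmf vimage_def mem_Collect_eq fst_conv .
qed

lemma label_arena: "s < 3 \<Longrightarrow> 0 \<in> label (arena p) s \<longleftrightarrow> s \<in> {1, 2}"
  "s < 3 \<Longrightarrow> 1 \<in> label (arena p) s \<longleftrightarrow> s = 1"
proof -
  have "s \<in> {0, 1, 2}" if "s < 3" using that by auto
  then show "s < 3 \<Longrightarrow> 0 \<in> label (arena p) s \<longleftrightarrow> s \<in> {1, 2}"
    "s < 3 \<Longrightarrow> 1 \<in> label (arena p) s \<longleftrightarrow> s = 1" by auto
qed

lemma configsD: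
  assumes "c \<in> configs V A" "x \<in> V"
  shows "fst (c x) < 3" "snd (c x) \<in> modes (A x)"
  using PiE_mem[OF assms(1)[unfolded configs_def] assms(2)] by (simp_all add: mem_Times_iff)

lemma set_kern_admissible:
  assumes "admissible p V m v" "c \<in> configs V (strats m)"
  shows "set_pmf (kern p V (strats m) c) \<subseteq> configs V (strats m)"
  using assms by (intro set_kern) (simp_all add: admissible_def)

lemma val_Next_Atom:
  assumes "admissible p V m v" "x \<in> V" "\<And>s. s < 3 \<Longrightarrow> a \<in> label (arena p) s \<longleftrightarrow> s \<in> B"
  shows "val (arena p) m v (Prob (Next (Atom a x))) =
    measure_pmf.prob (move p (strats m x) (init (strats m x) (the (v x))) (the (v x))) B"
proof -
  have "fst (c x) < 3" if "c \<in> set_pmf (kern p V (strats m) (start m v))" for c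
    using configsD(1)[OF subsetD[OF set_kern_admissible[OF assms(1) start_in_configs[OF assms(1)]] that] assms(2)] .
  \<comment> \<open>\<open>B\<close> agrees with the label on the three states only, so the two
    events are equal almost surely rather than literally.\<close>
  then have "measure_pmf.prob (kern p V (strats m) (start m v)) {c. a \<in> label (arena p) (fst (c x))} =
      measure_pmf.prob (kern p V (strats m) (start m v)) {c. fst (c x) \<in> B}"
    using assms(3) by (intro measure_pmf.finite_measure_eq_AE) (auto simp: AE_measure_pmf_iff)
  also have "\<dots> = measure_pmf.prob (move p (strats m x) (snd (start m v x)) (fst (start m v x))) {s. s \<in> B}"
    using assms by (intro prob_kern) (auto simp: admissible_def)
  also have "start m v x = (the (v x), init (strats m x) (the (v x)))"
    using assms(1,2) by (simp add: start_def admissible_def)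
  finally show ?thesis
    using assms(1,2) by (simp only: val_Next sat_Atom_at) simp
qed

lemma val_Until_Atom:
  assumes "admissible p V m v" "x \<in> V"
  shows "val (arena p) m v (Prob (Until TT (Atom 1 x))) =
    reach (kern p V (strats m)) (\<lambda>c. fst (c x) = 1) (start m v)"
  unfolding val_Until_TT[OF assms(1)] sat_Atom_at[OF assms]
proof (rule reach_cong[where I = "configs V (strats m)"])
  fix c assume c: "c \<in> configs V (strats m)"
  then have "fst (c x) < 3"
    using assms(2) by (rule configsD)
  with set_kern_admissible[OF assms(1) c] show "(1 \<in> label (arena p) (fst (c x))) = (fst (c x) = 1) \<and>
      set_pmf (kern p V (strats m) c) \<subseteq> configs V (strats m)"
    by (simp only: label_arena)
qed (rule start_in_configs[OF assms(1)])

section \<open>Formulas recognising the strategies that code numbers\<close>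

definition leave :: "strategy \<Rightarrow> nat \<Rightarrow> real" where
  "leave \<alpha> q = measure_pmf.prob (act \<alpha> q 0) {1, 2}"

text \<open>The second equation has the form \<open>a * a = a\<close>: the probability of accepting
  at once is 0 or 1.\<close>

definition steady :: "nat \<Rightarrow> svar set \<Rightarrow> (svar \<Rightarrow> strategy) \<Rightarrow> svar \<Rightarrow> (svar \<Rightarrow> state \<times> nat) \<Rightarrow> bool" where
  "steady p V A x c \<longleftrightarrow> (fst (c x) = 0 \<longrightarrow>
     leave (A x) (snd (c x)) = reach (kern p V A) (\<lambda>c. fst (c x) = 1) c \<and>
     pmf (act (A x) (snd (c x)) 0) 1 * pmf (act (A x) (snd (c x)) 0) 1 = pmf (act (A x) (snd (c x)) 0) 1)"

text \<open>An implication written with \<open>Neg\<close> and \<open>Conj\<close>.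
  \<open>Neg (Atom 0 x)\<close> says that \<open>x\<close> is in state 0, since atom 0 marks the
  other two states.\<close>

definition steady_form :: "svar \<Rightarrow> form" where
  "steady_form x = Neg (Conj (Neg (Atom 0 x)) (Neg (Conj
     (Cmp CEq (Prob (Next (Atom 0 x))) (Prob (Until TT (Atom 1 x))))
     (Cmp CEq (Arith ATimes (Prob (Next (Atom 1 x))) (Prob (Next (Atom 1 x)))) (Prob (Next (Atom 1 x)))))))"

text \<open>The first conjunct excludes staying forever, which satisfies all the equations with
  value 0. The second makes \<open>steady_form\<close> hold at every configuration that can be
  reached.\<close>

definition nat_form :: "svar \<Rightarrow> form" where
  "nat_form x = Conj (Cmp CGt (Prob (Next (Atom 0 x))) (Const 0))
     (Cmp CEq (Prob (Until TT (Neg (steady_form x)))) (Const 0))"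

lemma val_Next_end:
  assumes "admissible p V m v" "x \<in> V" "v x = Some 0"
  shows "val (arena p) m v (Prob (Next (Atom 0 x))) = leave (strats m x) (init (strats m x) 0)"
  using val_Next_Atom[OF assms(1,2) label_arena(1)] assms(3) by (simp add: move_def leave_def)

lemma val_Next_acc:
  assumes "admissible p V m v" "x \<in> V" "v x = Some 0"
  shows "val (arena p) m v (Prob (Next (Atom 1 x))) = pmf (act (strats m x) (init (strats m x) 0) 0) 1"
  using val_Next_Atom[OF assms(1,2), of 1 "{1}"] assms(3)
  by (simp add: label_arena[unfolded One_nat_def] move_def measure_pmf_single)

lemma val_Next_acc_1:
  assumes "admissible p V m v" "x \<in> V" "v x = Some 1"
  shows "val (arena p) m v (Prob (Next (Atom 1 x))) = 1 / (real p + 1)"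
  using val_Next_Atom[OF assms(1,2), of 1 "{1}"] assms(3)
  by (simp add: label_arena[unfolded One_nat_def] move_def measure_pmf_single pmf_if_bernoulli divide_le_eq_1)

text \<open>By \<open>kern_map_at\<close> and \<open>start_map_at\<close> the nested probabilities
  are those of the unchanged chain from \<open>c\<close>.\<close>

lemma sat_steady_form:
  assumes "admissible p V m v" "x \<in> V" "c \<in> configs V (strats m)"
  shows "sat (arena p) (map_at (arena p) m v c) (val_at v c) (steady_form x) \<longleftrightarrow> steady p V (strats m) x c"
proof (cases "fst (c x) = 0")
  case False
  have "fst (c x) < 3"
    using assms(3,2) by (rule configsD)
  with False have "0 \<in> label (arena p) (fst (c x))" by (auto simp: label_arena)
  with False show ?thesis
    using sat_Atom_at[OF assms(1,2)] by (simp add: steady_form_def steady_def)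
next
  case True
  note adm = admissible_map_at[OF assms(1,3)]
  have v: "val_at v c x = Some 0"
    using assms(1,2) True by (simp add: val_at_def admissible_def)
  have strats: "leave (strats (map_at (arena p) m v c) x) = leave (strats m x)"
    "act (strats (map_at (arena p) m v c) x) q 0 = act (strats m x) q 0"
    "init (strats (map_at (arena p) m v c) x) s = snd (c x)" for q s
    unfolding strats_map_at[OF assms(1,2)] by (auto simp: leave_def[abs_def] restrict_strategy_def)
  have "\<not> sat (arena p) (map_at (arena p) m v c) (val_at v c) (Atom 0 x)"
    using sat_Atom_at[OF assms(1,2)] True by simp
  then show ?thesis
    using True unfolding steady_form_def steady_def
    by (simp add: val_Next_end[OF adm assms(2) v] val_Next_acc[OF adm assms(2) v, unfolded One_nat_def]
        val_Until_Atom[OF adm assms(2), unfolded One_nat_def] strats kern_map_at[OF assms(1)] start_map_at[OF assms(1,3)]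
        del: val.simps(1) sat.simps(4))
qed

lemma sat_nat_form:
  assumes "admissible p V m v" "x \<in> V" "v x = Some 0"
  shows "sat (arena p) m v (nat_form x) \<longleftrightarrow>
    leave (strats m x) (init (strats m x) 0) > 0 \<and>
    reach (kern p V (strats m)) (\<lambda>c. \<not> steady p V (strats m) x c) (start m v) = 0"
proof -
  have "val (arena p) m v (Prob (Until TT (Neg (steady_form x)))) =
      reach (kern p V (strats m)) (\<lambda>c. \<not> steady p V (strats m) x c) (start m v)"
    unfolding val_Until_TT[OF assms(1)]
  proof (rule reach_cong[where I = "configs V (strats m)"])
    fix c assume c: "c \<in> configs V (strats m)"
    with set_kern_admissible[OF assms(1) c] show "sat (arena p) (map_at (arena p) m v c) (val_at v c) (Neg (steady_form x)) =
        (\<not> steady p V (strats m) x c) \<and> set_pmf (kern p V (strats m) c) \<subseteq> configs V (strats m)"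
      by (simp only: sat_steady_form[OF assms(1,2)] sat.simps)
  qed (rule start_in_configs[OF assms(1)])
  then show ?thesis
    by (simp add: nat_form_def val_Next_end[OF assms] del: val.simps(1))
qed

lemma fst_kern:
  assumes "finite V" "x \<in> V" "c' \<in> set_pmf (kern p V A c)"
  shows "fst (c' x) \<in> set_pmf (move p (A x) (snd (c x)) (fst (c x)))"
    and "snd (c' x) = mode (A x) (snd (c x)) (fst (c x))"
proof -
  have "c' x \<in> set_pmf (step p (A x) (c x))"
    using assms by (auto simp: kern_def set_Pi_pmf PiE_dflt_def)
  then show "fst (c' x) \<in> set_pmf (move p (A x) (snd (c x)) (fst (c x)))"
    "snd (c' x) = mode (A x) (snd (c x)) (fst (c x))"
    by (auto simp: step_def)
qed

lemma reach_accept_1: "fst (c x) = 1 \<Longrightarrow> reach (kern p V A) (\<lambda>c. fst (c x) = 1) c = 1"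
  by (subst reach_step) simp

text \<open>State 2 is absorbing, so the configurations with \<open>x\<close> in it form a closed
  set without acceptance.\<close>

lemma reach_accept_2:
  assumes "finite V" "x \<in> V" "fst (c x) = 2"
  shows "reach (kern p V A) (\<lambda>c. fst (c x) = 1) c = 0"
proof (rule reach_eq_0[where I = "{c. fst (c x) = 2}"])
  show "\<not> fst (s x) = 1 \<and> set_pmf (kern p V A s) \<subseteq> {c. fst (c x) = 2}" if "s \<in> {c. fst (c x) = 2}" for s
    using that fst_kern(1)[OF assms(1,2), of _ p A s] by (auto simp: move_def)
qed (use assms in simp)

text \<open>Induction on a bound for the reciprocal of the leaving probability. Each stay lowers the
  reciprocal by exactly 1, and it never falls below 1, so the descent ends at 1 and the reciprocal
  was a positive integer.\<close>

lemma steady_imp_reciprocal: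
  assumes V: "finite V" "x \<in> V" and A: "\<And>y. y \<in> V \<Longrightarrow> is_strategy (arena p) {1} (A y)"
    and "c \<in> configs V A" "reach (kern p V A) (\<lambda>c. \<not> steady p V A x c) c = 0" "fst (c x) = 0"
    and "leave (A x) (snd (c x)) > 0" "1 / leave (A x) (snd (c x)) \<le> real n + 1"
  shows "\<exists>k. leave (A x) (snd (c x)) = 1 / (real k + 1)"
  using assms(4-)
proof (induction n arbitrary: c)
  case 0
  then have "leave (A x) (snd (c x)) = 1"
    by (intro antisym) (auto simp: leave_def field_simps)
  then show ?case by (intro exI[of _ 0]) simp
next
  case (Suc n)
  let ?K = "kern p V A" and ?R = "reach (kern p V A) (\<lambda>c. fst (c x) = 1)"
  define q where "q = snd (c x)"
  define q' where "q' = mode (A x) q 0"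
  let ?\<mu> = "act (A x) q 0"
  note c = Suc.prems(2,3)
  have \<mu>: "set_pmf ?\<mu> \<subseteq> {..<3}"
    using A[OF V(2)] configsD(2)[OF Suc.prems(1) V(2)] by (simp add: is_strategy_arena q_def)
  have "steady p V A x c" using reach_eq_0D(1)[OF c(1)] by simp
  with c have R: "leave (A x) q = ?R c" and acc: "pmf ?\<mu> 1 * pmf ?\<mu> 1 = pmf ?\<mu> 1"
    by (auto simp: steady_def q_def)
  have leave_le: "leave (A x) q \<le> 1" by (simp add: leave_def)
  have split: "leave (A x) q = pmf ?\<mu> 1 + pmf ?\<mu> 2"
    by (simp add: leave_def measure_measure_pmf_finite)
  show ?case
  proof (cases "leave (A x) q = 1")
    case True
    then show ?thesis by (intro exI[of _ 0]) (simp add: q_def)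
  next
    case False
    \<comment> \<open>Accepting with probability 1 would make the probability of leaving equal to 1,
      which is the other case.\<close>
    with acc split have no_acc: "pmf ?\<mu> 1 = 0"
      using leave_le pmf_nonneg[of ?\<mu> 2] by (cases "pmf ?\<mu> 1 = 0") auto
    have move: "move p (A x) (snd (c x)) (fst (c x)) = ?\<mu>"
      using c by (simp add: move_def q_def)
    have "pmf ?\<mu> 0 + (pmf ?\<mu> 1 + pmf ?\<mu> 2) = (\<Sum>a<3. pmf ?\<mu> a)"
      by (simp add: lessThan_3)
    also have "\<dots> = 1" using \<mu> by (intro sum_pmf_eq_1) auto
    finally have "pmf ?\<mu> 0 = 1 - leave (A x) q" using split by linarith
    then have stay: "measure_pmf.prob (?K c) {c'. fst (c' x) = 0} = 1 - leave (A x) q"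
      using prob_kern[OF V, of p A c "\<lambda>s. s = 0"] move by (simp add: measure_pmf_single)
    \<comment> \<open>The mode update is deterministic, so all successors that stay in state 0 share
      the mode \<open>q'\<close> and hence one value.\<close>
    have R': "?R c' = leave (A x) q'" "snd (c' x) = q'" "reach ?K (\<lambda>c. \<not> steady p V A x c) c' = 0"
      if "c' \<in> set_pmf (?K c)" "fst (c' x) = 0" for c'
    proof -
      show "reach ?K (\<lambda>c. \<not> steady p V A x c) c' = 0"
        using reach_eq_0D(2)[OF c(1) that(1)] .
      from reach_eq_0D(1)[OF this] have "steady p V A x c'" by simp
      moreover show "snd (c' x) = q'"
        using fst_kern(2)[OF V that(1)] c(2) by (simp add: q_def q'_def)
      ultimately show "?R c' = leave (A x) q'"
        using that(2) by (simp add: steady_def)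
    qed
    have "?R c = measure_pmf.expectation (?K c) ?R"
      using c(2) by (subst reach_step) simp
    \<comment> \<open>No successor is in state 1, and those in state 2 contribute 0; only the stays
      remain.\<close>
    also have "\<dots> = measure_pmf.expectation (?K c) (\<lambda>c'. leave (A x) q' * indicator {c'. fst (c' x) = 0} c')"
    proof (rule integral_cong_AE)
      have "?R c' = leave (A x) q' * indicator {c'. fst (c' x) = 0} c'" if c': "c' \<in> set_pmf (?K c)" for c'
      proof -
        have "fst (c' x) \<in> set_pmf ?\<mu>" using fst_kern(1)[OF V c'] move by simp
        moreover from this have "fst (c' x) \<noteq> 1" using no_acc by (metis pmf_eq_0_set_pmf)
        moreover from subsetD[OF \<mu> calculation(1)] have "fst (c' x) \<in> {0, 1, 2}"
          unfolding lessThan_3 .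
        ultimately consider "fst (c' x) = 0" | "fst (c' x) = 2" by auto
        then show ?thesis
        proof cases
          case 1
          then show ?thesis using R'(1)[OF c'] by simp
        next
          case 2
          then show ?thesis using reach_accept_2[where c=c', OF V] by simp
        qed
      qed
      then show "AE c' in measure_pmf (?K c). ?R c' = leave (A x) q' * indicator {c'. fst (c' x) = 0} c'"
        by (simp add: AE_measure_pmf_iff)
    qed simp_all
    also have "\<dots> = leave (A x) q' * (1 - leave (A x) q)"
      by (simp add: stay)
    finally have rec: "leave (A x) q = leave (A x) q' * (1 - leave (A x) q)"
      using R by simp
    have pos: "0 < leave (A x) q" "leave (A x) q < 1"
      using Suc.prems(4) leave_le False by (auto simp: q_def)
    \<comment> \<open>Staying has positive probability, so there is a successor to which the
      induction hypothesis applies.\<close>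
    then have "measure_pmf.prob (?K c) {c'. fst (c' x) = 0} \<noteq> 0" using stay by simp
    then obtain c' where c': "c' \<in> set_pmf (?K c)" "fst (c' x) = 0"
      by (auto simp: measure_pmf_zero_iff)
    have "0 < leave (A x) q' * (1 - leave (A x) q)"
      using rec pos(1) by simp
    then have pos': "0 < leave (A x) q'"
      using pos(2) by (simp add: zero_less_mult_iff)
    have "1 / leave (A x) q' = 1 / leave (A x) q - 1"
      using rec pos pos' by (simp add: field_simps)
    then have "1 / leave (A x) q' \<le> real n + 1"
      using Suc.prems(5) by (simp add: q_def)
    then obtain k where k: "leave (A x) q' = 1 / (real k + 1)"
      using Suc.IH[of c'] set_kern[OF V(1) A Suc.prems(1)] c'(1) R'(2,3)[OF c'] c'(2) pos' by auto
    have "leave (A x) q = 1 / (real (Suc k) + 1)"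
      using rec unfolding k by (simp add: field_simps)
    then show ?thesis unfolding q_def by blast
  qed
qed

section \<open>A counting strategy for every number\<close>

definition counter :: "nat \<Rightarrow> strategy" where
  "counter n =
     \<lparr>modes = UNIV, init = \<lambda>_. n, mode = \<lambda>q _. q - 1,
      act = \<lambda>q _. if q = 0 then return_pmf 1
        else map_pmf (\<lambda>b. if b then 2 else 0) (bernoulli_pmf (1 / (real q + 1)))\<rparr>"

lemma is_strategy_counter: "is_strategy (arena p) {1} (counter n)"
  by (auto simp: is_strategy_arena counter_def)

lemma act_counter:
  "pmf (act (counter n) 0 s) 1 = 1" "pmf (act (counter n) (Suc q) s) 1 = 0"
  "pmf (act (counter n) 0 s) 2 = 0" "pmf (act (counter n) (Suc q) s) 2 = 1 / (real q + 2)"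
  "pmf (act (counter n) (Suc q) s) 0 = 1 - 1 / (real q + 2)"
  by (simp_all add: counter_def pmf_if_bernoulli divide_le_eq_1 add.commute)

lemma leave_counter: "leave (counter n) q = 1 / (real q + 1)"
  by (cases q) (simp_all add: leave_def measure_measure_pmf_finite act_counter[unfolded One_nat_def] add.commute)

text \<open>From mode \<open>q\<close> the survival probabilities telescope: q/(q+1) times (q-1)/q
  down to 1/2 gives 1/(q+1), and mode 0 accepts. The hypotheses fix only the choices in state 0 and
  the mode update, so restricted copies of \<open>counter\<close> are covered.\<close>

lemma reach_counter:
  assumes V: "finite V" "x \<in> V"
    and A: "\<And>q. act (A x) q 0 = act (counter n) q 0" "mode (A x) = mode (counter n)"
    and "fst (c x) = 0"
  shows "reach (kern p V A) (\<lambda>c. fst (c x) = 1) c = 1 / (real (snd (c x)) + 1)"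
  using assms(5)
proof (induction "snd (c x)" arbitrary: c)
  let ?K = "kern p V A" and ?R = "reach (kern p V A) (\<lambda>c. fst (c x) = 1)"
  case 0
  have "?R c' = 1" if "c' \<in> set_pmf (?K c)" for c'
    using fst_kern(1)[OF V that] 0 by (intro reach_accept_1) (simp add: move_def A counter_def)
  then have "measure_pmf.expectation (?K c) ?R = measure_pmf.expectation (?K c) (\<lambda>_. 1)"
    by (intro integral_cong_AE) (simp_all add: AE_measure_pmf_iff)
  then show ?case using 0 by (subst reach_step) simp
next
  let ?K = "kern p V A" and ?R = "reach (kern p V A) (\<lambda>c. fst (c x) = 1)"
  case (Suc q)
  have "?R c' = 1 / (real q + 1) * indicator {c'. fst (c' x) = 0} c'" if c': "c' \<in> set_pmf (?K c)" for c'
  proof -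
    have "snd (c' x) = q"
      using fst_kern(2)[OF V c'] Suc.hyps(2)[symmetric] by (simp add: A counter_def)
    moreover have "fst (c' x) = 0 \<or> fst (c' x) = 2"
      using fst_kern(1)[OF V c'] Suc.hyps(2)[symmetric] Suc.prems
      by (auto simp: move_def A counter_def split: if_splits)
    ultimately show ?thesis
      using Suc.hyps(1)[of c'] reach_accept_2[where c=c', OF V] by auto
  qed
  then have "measure_pmf.expectation (?K c) ?R =
      measure_pmf.expectation (?K c) (\<lambda>c'. 1 / (real q + 1) * indicator {c'. fst (c' x) = 0} c')"
    by (intro integral_cong_AE) (simp_all add: AE_measure_pmf_iff)
  also have "\<dots> = 1 / (real q + 1) * measure_pmf.prob (?K c) {c'. fst (c' x) = 0}"
    by simp
  also have "measure_pmf.prob (?K c) {c'. fst (c' x) = 0} = 1 - 1 / (real q + 2)"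
    using prob_kern[OF V, of p A c "\<lambda>s. s = 0"] Suc.prems Suc.hyps(2)[symmetric]
    by (simp add: move_def A act_counter measure_pmf_single)
  finally show ?case
    using Suc.prems Suc.hyps(2)[symmetric] by (subst reach_step) (simp add: field_simps)
qed

lemma steady_counter:
  assumes "finite V" "x \<in> V" "\<And>q. act (A x) q 0 = act (counter n) q 0" "mode (A x) = mode (counter n)"
  shows "steady p V A x c"
proof -
  have "leave (A x) = leave (counter n)" using assms(3) by (simp add: leave_def[abs_def])
  moreover have "pmf (act (counter n) q 0) 1 * pmf (act (counter n) q 0) 1 = pmf (act (counter n) q 0) 1" for q
    by (cases q) (simp_all add: act_counter[unfolded One_nat_def])
  ultimately show ?thesis
    using reach_counter[where A=A, OF assms] by (simp add: steady_def leave_counter assms(3))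
qed

definition codes :: "strategy \<Rightarrow> nat \<Rightarrow> bool" where
  "codes \<alpha> n \<longleftrightarrow> leave \<alpha> (init \<alpha> 0) = 1 / (real n + 1)"

lemma sat_nat_formD:
  assumes "admissible p V m v" "x \<in> V" "v x = Some 0" "sat (arena p) m v (nat_form x)"
  shows "\<exists>n. codes (strats m x) n"
proof -
  note n = sat_nat_form[OF assms(1-3), THEN iffD1, OF assms(4)]
  have V: "finite V" and A: "\<And>y. y \<in> V \<Longrightarrow> is_strategy (arena p) {1} (strats m y)"
    and st: "start m v x = (0, init (strats m x) 0)"
    using assms(1-3) by (auto simp: admissible_def start_def)
  have "\<exists>k. leave (strats m x) (snd (start m v x)) = 1 / (real k + 1)"
  \<comment> \<open>The reciprocal rounded up serves as the bound for the induction.\<close>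
  proof (rule steady_imp_reciprocal[where n = "nat \<lceil>1 / leave (strats m x) (snd (start m v x))\<rceil>", OF V assms(2) A])
    show "start m v \<in> configs V (strats m)" by (rule start_in_configs[OF assms(1)])
    show "1 / leave (strats m x) (snd (start m v x)) \<le> real (nat \<lceil>1 / leave (strats m x) (snd (start m v x))\<rceil>) + 1"
      by linarith
  qed (use n st in simp_all)
  then show ?thesis by (simp add: codes_def st)
qed

lemma sat_nat_form_counter:
  assumes "admissible p V m v" "x \<in> V" "v x = Some 0"
    and m: "strats m x = restrict_strategy (arena p) 1 (counter n)"
  shows "sat (arena p) m v (nat_form x)" "codes (strats m x) n"
proof -
  have A: "act (strats m x) q 0 = act (counter n) q 0" "mode (strats m x) = mode (counter n)"
    "init (strats m x) 0 = n" for q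
    unfolding m by (simp_all add: restrict_strategy_def counter_def)
  then have leave: "leave (strats m x) q = 1 / (real q + 1)" for q
    using leave_counter[of n q] by (simp add: leave_def)
  then show "codes (strats m x) n" by (simp add: codes_def A)
  have V: "finite V" using assms(1) by (simp add: admissible_def)
  have "steady p V (strats m) x c" for c
    by (rule steady_counter[where A = "strats m", OF V assms(2) A(1,2)])
  \<comment> \<open>No configuration violates the condition, so the set of all configurations is the
    closed set.\<close>
  then have "reach (kern p V (strats m)) (\<lambda>c. \<not> steady p V (strats m) x c) (start m v) = 0"
    by (intro reach_eq_0[where I = UNIV]) simp_all
  then show "sat (arena p) m v (nat_form x)"
    using leave by (simp add: sat_nat_form[OF assms(1-3)] A)
qed

section \<open>Arithmetical definability of recursive functions\<close>

text \<open>Atoms relate variables only, so that each becomes one equation between probabilities;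
  terms are recovered through \<open>definable_fun\<close>.\<close>

datatype fo = FAdd nat nat nat | FMul nat nat nat | FNeg fo | FConj fo fo | FEx nat fo

primrec fo_sat :: "(nat \<Rightarrow> nat) \<Rightarrow> fo \<Rightarrow> bool" where
  "fo_sat e (FAdd x y z) \<longleftrightarrow> e x + e y = e z"
| "fo_sat e (FMul x y z) \<longleftrightarrow> e x * e y = e z"
| "fo_sat e (FNeg \<phi>) \<longleftrightarrow> \<not> fo_sat e \<phi>"
| "fo_sat e (FConj \<phi> \<psi>) \<longleftrightarrow> fo_sat e \<phi> \<and> fo_sat e \<psi>"
| "fo_sat e (FEx z \<phi>) \<longleftrightarrow> (\<exists>n. fo_sat (e(z := n)) \<phi>)"

text \<open>Demanding a formula for every tuple \<open>xs\<close> of variables makes renaming free of charge.\<close>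

definition definable :: "nat \<Rightarrow> (nat list \<Rightarrow> bool) \<Rightarrow> bool" where
  "definable k R \<longleftrightarrow> (\<forall>xs. length xs = k \<longrightarrow> (\<exists>\<phi>. \<forall>e. fo_sat e \<phi> \<longleftrightarrow> R (map e xs)))"

definition definable_fun :: "nat \<Rightarrow> (nat list \<Rightarrow> nat) \<Rightarrow> bool" where
  "definable_fun k t \<longleftrightarrow> definable (Suc k) (\<lambda>ns. hd ns = t (tl ns))"

lemma definable_cong:
  assumes "\<And>ns. length ns = k \<Longrightarrow> R ns \<longleftrightarrow> R' ns"
  shows "definable k R \<longleftrightarrow> definable k R'"
  using assms by (simp add: definable_def)

lemma definable_not: "definable k R \<Longrightarrow> definable k (\<lambda>ns. \<not> R ns)"
  unfolding definable_def by (metis fo_sat.simps(3))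

lemma definable_conj: "definable k R \<Longrightarrow> definable k R' \<Longrightarrow> definable k (\<lambda>ns. R ns \<and> R' ns)"
  unfolding definable_def by (metis fo_sat.simps(4))

lemma definable_imp: "definable k R \<Longrightarrow> definable k R' \<Longrightarrow> definable k (\<lambda>ns. R ns \<longrightarrow> R' ns)"
  using definable_not[OF definable_conj[OF _ definable_not]] by simp

lemma definable_ex:
  assumes "definable (Suc k) R"
  shows "definable k (\<lambda>ns. \<exists>n. R (n # ns))"
  unfolding definable_def
proof (intro allI impI)
  fix xs :: "nat list" assume "length xs = k"
  \<comment> \<open>Rebinding a fresh variable leaves the values of \<open>xs\<close>
    intact.\<close>
  obtain z where z: "z \<notin> set xs" using ex_new_if_finite[OF infinite_UNIV_nat] by blast
  from \<open>length xs = k\<close> assms obtain \<phi> where "\<And>e. fo_sat e \<phi> \<longleftrightarrow> R (map e (z # xs))"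
    unfolding definable_def by (metis length_Cons)
  moreover have "map (e(z := n)) xs = map e xs" for e and n :: nat
    using z by auto
  ultimately have "\<forall>e. fo_sat e (FEx z \<phi>) \<longleftrightarrow> (\<exists>n. R (n # map e xs))"
    by (simp only: fo_sat.simps list.map fun_upd_same simp_thms)
  then show "\<exists>\<phi>. \<forall>e. fo_sat e \<phi> \<longleftrightarrow> (\<exists>n. R (n # map e xs))" ..
qed

lemma definable_all:
  assumes "definable (Suc k) R"
  shows "definable k (\<lambda>ns. \<forall>n. R (n # ns))"
  using definable_not[OF definable_ex[OF definable_not[OF assms]]] by simp

lemma definable_ex_list:
  "definable (j + k) R \<Longrightarrow> definable k (\<lambda>ns. \<exists>zs. length zs = j \<and> R (zs @ ns))"
proof (induction j arbitrary: R)
  case (Suc j)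
  then have "definable k (\<lambda>ns. \<exists>zs. length zs = j \<and> (\<exists>z. R (z # zs @ ns)))"
    using definable_ex[of "j + k" R] by simp
  moreover have "(\<exists>zs. length zs = Suc j \<and> R (zs @ ns)) \<longleftrightarrow> (\<exists>zs. length zs = j \<and> (\<exists>z. R (z # zs @ ns)))" for ns
    by (metis append_Cons length_Suc_conv)
  ultimately show ?case by simp
qed simp

text \<open>A formula is available for every tuple of variables, so repeating, dropping or permuting
  positions only means choosing another tuple.\<close>

lemma definable_select:
  assumes "definable (length is) R" "\<forall>i\<in>set is. i < k"
  shows "definable k (\<lambda>ns. R (map ((!) ns) is))"
  unfolding definable_def
proof (intro allI impI)
  fix xs :: "nat list" assume xs: "length xs = k"
  obtain \<phi> where \<phi>: "\<And>e. fo_sat e \<phi> \<longleftrightarrow> R (map e (map ((!) xs) is))"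
    using assms(1) unfolding definable_def by (metis length_map)
  have "map e (map ((!) xs) is) = map ((!) (map e xs)) is" for e :: "nat \<Rightarrow> nat"
    using assms(2) xs by simp
  with \<phi> show "\<exists>\<phi>. \<forall>e. fo_sat e \<phi> \<longleftrightarrow> R (map ((!) (map e xs)) is)" by metis
qed

section \<open>Definability of arithmetical relations and functions\<close>

lemma definable_add: "definable 3 (\<lambda>ns. ns ! 0 + ns ! 1 = ns ! 2)"
  unfolding definable_def
proof (intro allI impI exI)
  fix xs :: "nat list" and e
  assume "length xs = 3"
  then show "fo_sat e (FAdd (xs ! 0) (xs ! 1) (xs ! 2)) \<longleftrightarrow> map e xs ! 0 + map e xs ! 1 = map e xs ! 2"
    by simp
qed

lemma definable_mult: "definable 3 (\<lambda>ns. ns ! 0 * ns ! 1 = ns ! 2)"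
  unfolding definable_def
proof (intro allI impI exI)
  fix xs :: "nat list" and e
  assume "length xs = 3"
  then show "fo_sat e (FMul (xs ! 0) (xs ! 1) (xs ! 2)) \<longleftrightarrow> map e xs ! 0 * map e xs ! 1 = map e xs ! 2"
    by simp
qed

text \<open>0 is the only number with \<open>n + n = n\<close>.\<close>

lemma definable_zero: "definable 1 (\<lambda>ns. ns ! 0 = 0)"
proof -
  have "definable 1 (\<lambda>ns. ns ! 0 + ns ! 0 = ns ! 0)"
    using definable_select[of "[0, 0, 0]" "\<lambda>ns. ns ! 0 + ns ! 1 = ns ! 2" 1] definable_add
    by (simp add: numeral_3_eq_3 numeral_2_eq_2)
  then show ?thesis by simp
qed

text \<open>Equality is addition of a 0 that is quantified away.\<close>

lemma definable_eq: "definable 2 (\<lambda>ns. ns ! 0 = ns ! 1)"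
proof -
  have "definable 3 (\<lambda>ns. ns ! 0 = 0)" "definable 3 (\<lambda>ns. ns ! 1 + ns ! 0 = ns ! 2)"
    using definable_select[of "[0]" "\<lambda>ns. ns ! 0 = 0" 3] definable_zero
      definable_select[of "[1, 0, 2]" "\<lambda>ns. ns ! 0 + ns ! 1 = ns ! 2" 3] definable_add
    by (simp_all add: numeral_3_eq_3 numeral_2_eq_2)
  from definable_conj[OF this] have "definable (Suc 2) (\<lambda>ns. ns ! 0 = 0 \<and> ns ! 1 + ns ! 0 = ns ! 2)"
    by (simp add: numeral_3_eq_3 numeral_2_eq_2)
  from definable_ex[OF this] show ?thesis by (simp add: numeral_2_eq_2)
qed

lemma definable_True: "definable k (\<lambda>_. True)"
proof -
  have "fo_sat e (FNeg (FConj (FAdd 0 0 0) (FNeg (FAdd 0 0 0))))" for e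
    by (simp only: fo_sat.simps) blast
  then show ?thesis unfolding definable_def by blast
qed

lemma definable_False: "definable k (\<lambda>_. False)"
  using definable_not[OF definable_True] by simp

lemma definable_finite_all:
  assumes "finite I" "\<And>i. i \<in> I \<Longrightarrow> definable k (R i)"
  shows "definable k (\<lambda>ns. \<forall>i\<in>I. R i ns)"
  using assms
  by (induction I) (simp_all add: definable_True definable_conj)

text \<open>The values of the terms are guessed in new leading positions, one for each term. The
  graph of each term pins its value down, and \<open>R\<close> is applied to these
  positions.\<close>

lemma definable_subst:
  assumes "definable (length ts) R" "\<And>t. t \<in> set ts \<Longrightarrow> definable_fun k t"
  shows "definable k (\<lambda>ns. R (map (\<lambda>t. t ns) ts))"
proof -
  let ?j = "length ts"
  have "definable (?j + k) (\<lambda>ms. ms ! i = (ts ! i) (drop ?j ms))" if "i < ?j" for i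
  proof -
    have "definable (?j + k) (\<lambda>ms. hd (map ((!) ms) (i # [?j..<?j + k])) = (ts ! i) (tl (map ((!) ms) (i # [?j..<?j + k]))))"
      using assms(2)[of "ts ! i"] that
      by (intro definable_select[where R = "\<lambda>ns. hd ns = (ts ! i) (tl ns)"]) (auto simp: definable_fun_def)
    moreover have "map ((!) ms) [?j..<?j + k] = drop ?j ms" if "length ms = ?j + k" for ms :: "nat list"
      using that by (intro nth_equalityI) auto
    ultimately show ?thesis by (subst (asm) definable_cong) auto
  qed
  then have "definable (?j + k) (\<lambda>ms. \<forall>i\<in>{..<?j}. ms ! i = (ts ! i) (drop ?j ms))"
    by (intro definable_finite_all) auto
  moreover have "definable (?j + k) (\<lambda>ms. R (map ((!) ms) [0..<?j]))"
    using assms(1) by (intro definable_select) auto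
  ultimately have "definable (?j + k) (\<lambda>ms. (\<forall>i\<in>{..<?j}. ms ! i = (ts ! i) (drop ?j ms)) \<and> R (map ((!) ms) [0..<?j]))"
    by (rule definable_conj)
  from definable_ex_list[OF this]
  have "definable k (\<lambda>ns. \<exists>zs. length zs = ?j \<and>
      (\<forall>i\<in>{..<?j}. (zs @ ns) ! i = (ts ! i) (drop ?j (zs @ ns))) \<and> R (map ((!) (zs @ ns)) [0..<?j]))" .
  moreover have "(\<exists>zs. length zs = ?j \<and>
      (\<forall>i\<in>{..<?j}. (zs @ ns) ! i = (ts ! i) (drop ?j (zs @ ns))) \<and> R (map ((!) (zs @ ns)) [0..<?j])) \<longleftrightarrow>
      R (map (\<lambda>t. t ns) ts)" (is "?L \<longleftrightarrow> _") for ns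
  proof -
    have "map ((!) (zs @ ns)) [0..<?j] = zs" if "length zs = ?j" for zs
      using that by (intro nth_equalityI) (auto simp: nth_append)
    moreover have "(\<forall>i\<in>{..<?j}. (zs @ ns) ! i = (ts ! i) (drop ?j (zs @ ns))) \<longleftrightarrow> zs = map (\<lambda>t. t ns) ts" if "length zs = ?j" for zs
      using that by (auto simp: nth_append list_eq_iff_nth_eq)
    ultimately have "length zs = ?j \<and>
        (\<forall>i\<in>{..<?j}. (zs @ ns) ! i = (ts ! i) (drop ?j (zs @ ns))) \<and> R (map ((!) (zs @ ns)) [0..<?j]) \<longleftrightarrow>
        zs = map (\<lambda>t. t ns) ts \<and> R zs" for zs
      by (metis length_map)
    then show ?thesis by simp
  qed
  ultimately show ?thesis by simp
qed

lemma definable_fun_nth: "i < k \<Longrightarrow> definable_fun k (\<lambda>ns. ns ! i)"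
proof -
  assume i: "i < k"
  have "definable (Suc k) (\<lambda>ns. map ((!) ns) [0, Suc i] ! 0 = map ((!) ns) [0, Suc i] ! 1)"
    using definable_eq i by (intro definable_select[where R = "\<lambda>ns. ns ! 0 = ns ! 1"]) (auto simp: numeral_2_eq_2)
  then show ?thesis
    unfolding definable_fun_def by (subst (asm) definable_cong) (auto simp: length_Suc_conv)
qed

text \<open>In the graph, position 0 carries the value and position 1 the additional argument, which
  the selection of positions skips.\<close>

lemma definable_fun_lift:
  assumes "definable_fun k t" shows "definable_fun (Suc k) (\<lambda>ns. t (tl ns))"
proof -
  have "definable (Suc (Suc k)) (\<lambda>ns. hd (map ((!) ns) (0 # [Suc (Suc 0)..<Suc (Suc k)])) = t (tl (map ((!) ns) (0 # [Suc (Suc 0)..<Suc (Suc k)]))))"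
    using assms by (intro definable_select[where R = "\<lambda>ns. hd ns = t (tl ns)"]) (auto simp: definable_fun_def simp del: upt_Suc)
  moreover have "hd (map ((!) ns) (0 # [Suc (Suc 0)..<Suc (Suc k)])) = t (tl (map ((!) ns) (0 # [Suc (Suc 0)..<Suc (Suc k)]))) \<longleftrightarrow> hd ns = t (tl (tl ns))"
    if "length ns = Suc (Suc k)" for ns
  proof -
    have "map ((!) ns) [Suc (Suc 0)..<Suc (Suc k)] = tl (tl ns)"
      using that by (intro nth_equalityI) (auto simp: nth_tl simp del: upt_Suc)
    moreover have "hd ns = ns ! 0" using that by (cases ns) auto
    ultimately show ?thesis by (simp del: upt_Suc)
  qed
  ultimately show ?thesis
    unfolding definable_fun_def by (subst (asm) definable_cong) auto
qed

lemma definable_fun_hd: "definable_fun (Suc k) hd"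
proof -
  have "definable (Suc (Suc k)) (\<lambda>ns. hd ns = hd (tl ns)) \<longleftrightarrow> definable (Suc (Suc k)) (\<lambda>ns. hd ns = tl ns ! 0)"
    by (rule definable_cong) (auto simp: length_Suc_conv)
  then show ?thesis
    using definable_fun_nth[of 0 "Suc k"] by (simp add: definable_fun_def)
qed

lemma definable_subst1:
  "definable 1 (\<lambda>ns. R (ns ! 0)) \<Longrightarrow> definable_fun k s \<Longrightarrow> definable k (\<lambda>ns. R (s ns))"
  using definable_subst[of "[s]" "\<lambda>ns. R (ns ! 0)" k] by simp

lemma definable_subst2:
  "definable 2 (\<lambda>ns. R (ns ! 0) (ns ! 1)) \<Longrightarrow> definable_fun k s \<Longrightarrow> definable_fun k t \<Longrightarrow>
    definable k (\<lambda>ns. R (s ns) (t ns))"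
  using definable_subst[of "[s, t]" "\<lambda>ns. R (ns ! 0) (ns ! 1)" k] by (auto simp: numeral_2_eq_2)

lemma definable_subst3:
  "definable 3 (\<lambda>ns. R (ns ! 0) (ns ! 1) (ns ! 2)) \<Longrightarrow> definable_fun k s \<Longrightarrow> definable_fun k t \<Longrightarrow>
    definable_fun k u \<Longrightarrow> definable k (\<lambda>ns. R (s ns) (t ns) (u ns))"
  using definable_subst[of "[s, t, u]" "\<lambda>ns. R (ns ! 0) (ns ! 1) (ns ! 2)" k] by (auto simp: numeral_3_eq_3)

lemmas definable_eqI = definable_subst2[where R = "(=)", OF definable_eq]

lemma definable_funI:
  assumes "definable (Suc k) R" "\<And>n ns. length ns = k \<Longrightarrow> R (n # ns) \<longleftrightarrow> n = t ns"
  shows "definable_fun k t"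
  using assms unfolding definable_fun_def
  by (subst definable_cong[where R' = R]) (auto simp: length_Suc_conv)

lemma definable_fun_plus:
  assumes "definable_fun k s" "definable_fun k t"
  shows "definable_fun k (\<lambda>ns. s ns + t ns)"
proof (rule definable_funI)
  show "definable (Suc k) (\<lambda>ns. s (tl ns) + t (tl ns) = hd ns)"
    by (intro definable_subst3[where R = "\<lambda>a b c. a + b = c", OF definable_add] definable_fun_lift assms definable_fun_hd)
qed auto

lemma definable_fun_times:
  assumes "definable_fun k s" "definable_fun k t"
  shows "definable_fun k (\<lambda>ns. s ns * t ns)"
proof (rule definable_funI)
  show "definable (Suc k) (\<lambda>ns. s (tl ns) * t (tl ns) = hd ns)"
    by (intro definable_subst3[where R = "\<lambda>a b c. a * b = c", OF definable_mult] definable_fun_lift assms definable_fun_hd)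
qed auto

lemma definable_fun_0: "definable_fun k (\<lambda>_. 0)"
  by (rule definable_funI[OF definable_subst1[where R = "\<lambda>n. n = 0", OF definable_zero definable_fun_hd]]) simp

lemma definable_fun_1: "definable_fun k (\<lambda>_. 1)"
proof (rule definable_funI)
  \<comment> \<open>1 is the only nonzero idempotent.\<close>
  show "definable (Suc k) (\<lambda>ns. hd ns * hd ns = hd ns \<and> \<not> hd ns = 0)"
    by (intro definable_conj definable_not definable_eqI definable_fun_times definable_fun_hd definable_fun_0)
qed auto

lemma definable_fun_Suc: "definable_fun k t \<Longrightarrow> definable_fun k (\<lambda>ns. Suc (t ns))"
  using definable_fun_plus[OF _ definable_fun_1] by simp

lemma definable_fun_const: "definable_fun k (\<lambda>_. n)"
  by (induction n) (simp_all add: definable_fun_0 definable_fun_Suc)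

lemmas definable_intros =
  definable_fun_nth definable_fun_hd definable_fun_lift definable_fun_plus definable_fun_times
  definable_fun_Suc definable_fun_const definable_eqI definable_not definable_conj definable_imp

lemma definable_less:
  assumes "definable_fun k s" "definable_fun k t"
  shows "definable k (\<lambda>ns. s ns < t ns)"
proof -
  have "definable (Suc k) (\<lambda>ns. Suc (s (tl ns) + hd ns) = t (tl ns))"
    by (intro definable_intros assms)
  from definable_ex[OF this] show ?thesis by (simp add: less_iff_Suc_add eq_commute)
qed

text \<open>Division with remainder. The successor keeps the modulus positive, so the remainder is
  characterised by lying below it.\<close>

lemma definable_fun_mod_Suc:
  assumes "definable_fun k s" "definable_fun k t"
  shows "definable_fun k (\<lambda>ns. s ns mod Suc (t ns))"
proof (rule definable_funI)
  have "definable (Suc (Suc k)) (\<lambda>ns. s (tl (tl ns)) = hd ns * Suc (t (tl (tl ns))) + hd (tl ns))"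
    by (intro definable_intros definable_fun_lift[where t = "\<lambda>ns. s (tl ns)"]
        definable_fun_lift[where t = "\<lambda>ns. t (tl ns)"] definable_fun_lift[where t = hd] assms)
  from definable_ex[OF this]
  show "definable (Suc k) (\<lambda>ns. hd ns < Suc (t (tl ns)) \<and> (\<exists>q. s (tl ns) = q * Suc (t (tl ns)) + hd ns))"
    by (intro definable_conj definable_less definable_intros assms) simp
  show "hd (n # ns) < Suc (t (tl (n # ns))) \<and> (\<exists>q. s (tl (n # ns)) = q * Suc (t (tl (n # ns))) + hd (n # ns))
      \<longleftrightarrow> n = s ns mod Suc (t ns)" for n ns
    by (auto simp: mod_mult_self3 simp del: mult_Suc_right) (metis div_mult_mod_eq)
qed

section \<open>Goedel's beta function for coding finite sequences\<close>

definition beta :: "nat \<Rightarrow> nat \<Rightarrow> nat \<Rightarrow> nat" where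
  "beta c d i = c mod Suc (Suc i * d)"

lemma definable_fun_beta:
  "definable_fun k c \<Longrightarrow> definable_fun k d \<Longrightarrow> definable_fun k i \<Longrightarrow>
    definable_fun k (\<lambda>ns. beta (c ns) (d ns) (i ns))"
  unfolding beta_def by (intro definable_fun_mod_Suc definable_intros)

text \<open>A common divisor is coprime to \<open>fact M\<close>, because it divides a multiple of
  \<open>fact M\<close> plus 1. It also divides \<open>(j - i) * fact M\<close>, hence
  \<open>j - i\<close>, hence \<open>fact M\<close>, and so it is a unit.\<close>

lemma coprime_beta_moduli:
  assumes "i < j" "j \<le> M"
  shows "coprime (Suc (Suc i * fact M)) (Suc (Suc j * fact M))"
proof (rule coprimeI)
  fix r :: nat
  assume r: "r dvd Suc (Suc i * fact M)" "r dvd Suc (Suc j * fact M)"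
  have "coprime r (fact M)"
  proof (rule coprimeI)
    fix e assume e: "e dvd r" "e dvd fact M"
    then have "e dvd Suc i * fact M" "e dvd Suc (Suc i * fact M)"
      using r(1) by (auto intro: dvd_trans)
    then show "is_unit e" by (metis Suc_eq_plus1 dvd_add_right_iff)
  qed
  moreover have "r dvd (j - i) * fact M"
    using dvd_diff_nat[OF r(2,1)] by (simp add: diff_mult_distrib[symmetric])
  ultimately have "r dvd j - i"
    by (simp add: coprime_dvd_mult_left_iff)
  then have "r dvd fact M"
    using assms dvd_fact[of "j - i" M] by (auto intro: dvd_trans)
  with \<open>coprime r (fact M)\<close> show "is_unit r"
    using coprime_common_divisor[of r "fact M" r] by simp
qed

text \<open>By the Chinese remainder theorem. \<open>M\<close> dominates the indices, which makes
  the moduli coprime, and also the values, which are then smaller than the moduli and equal to their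
  residues.\<close>

lemma beta_surj: "\<exists>c d. \<forall>i<n. beta c d i = a i"
proof -
  define M where "M = n + (\<Sum>i<n. a i)"
  define m where "m i = Suc (Suc i * fact M)" for i
  have "coprime (m i) (m j)" if "i < n" "j < n" "i \<noteq> j" for i j
    using that coprime_beta_moduli[of i j M] coprime_beta_moduli[of j i M]
    by (cases i j rule: linorder_cases) (auto simp: m_def M_def coprime_commute)
  then obtain c where c: "\<And>i. i < n \<Longrightarrow> [c = a i] (mod m i)"
    using chinese_remainder_nat[of "{..<n}" m a] by auto
  have "beta c (fact M) i = a i" if "i < n" for i
  proof -
    have "a i \<le> (\<Sum>i<n. a i)"
      using that by (intro member_le_sum) auto
    also have "\<dots> \<le> fact M" unfolding M_def by (rule order_trans[OF _ fact_ge_self]) simp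
    also have "\<dots> < m i" by (simp add: m_def)
    finally show ?thesis
      using c[OF that] by (simp add: beta_def cong_def m_def)
  qed
  then show ?thesis by blast
qed

section \<open>Graphs of partial recursive functions\<close>

definition representable :: "recf \<Rightarrow> bool" where
  "representable f \<longleftrightarrow> (\<forall>k. definable (Suc k) (\<lambda>ns. evaluates f (tl ns) (hd ns)))"

lemma definable_evaluates:
  assumes "representable f" "definable_fun k t" "\<And>s. s \<in> set ss \<Longrightarrow> definable_fun k s"
  shows "definable k (\<lambda>ns. evaluates f (map (\<lambda>s. s ns) ss) (t ns))"
  using definable_subst[of "t # ss" "\<lambda>ns. evaluates f (tl ns) (hd ns)" k] assms
  by (auto simp: representable_def)

text \<open>For use where the arguments sit behind \<open>j\<close> leading positions of the tuple
  that hold auxiliary values.\<close>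

lemma definable_evaluates_drop:
  assumes "representable f" "definable_fun (j + k) t" "\<And>s. s \<in> set ss \<Longrightarrow> definable_fun (j + k) s"
  shows "definable (j + k) (\<lambda>ns. evaluates f (map (\<lambda>s. s ns) ss @ drop j ns) (t ns))"
proof -
  have "definable (j + k) (\<lambda>ns. evaluates f (map (\<lambda>s. s ns) (ss @ map (\<lambda>i ns. ns ! i) [j..<j + k])) (t ns))"
    using assms by (intro definable_evaluates) (auto intro: definable_fun_nth)
  moreover have "map ((!) ns) [j..<j + k] = drop j ns" if "length ns = j + k" for ns :: "nat list"
    using that by (intro nth_equalityI) auto
  ultimately show ?thesis
    by (subst definable_cong[where R' = "\<lambda>ns. evaluates f (map (\<lambda>s. s ns) (ss @ map (\<lambda>i ns. ns ! i) [j..<j + k])) (t ns)"])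
      (auto simp: comp_def)
qed

inductive_cases evaluates_ZeroE: "evaluates Zero xs y"
inductive_cases evaluates_SuccE: "evaluates Succ xs y"
inductive_cases evaluates_ProjE: "evaluates (Proj i) xs y"
inductive_cases evaluates_CompE: "evaluates (Comp f gs) xs y"
inductive_cases evaluates_PrimRecE: "evaluates (PrimRec f g) xs y"
inductive_cases evaluates_PrimRec_0E: "evaluates (PrimRec f g) (0 # xs) y"
inductive_cases evaluates_PrimRec_SucE: "evaluates (PrimRec f g) (Suc n # xs) y"
inductive_cases evaluates_MuE: "evaluates (Mu f) xs y"

lemma evaluates_functional: "evaluates f xs y \<Longrightarrow> evaluates f xs z \<Longrightarrow> y = z"
proof (induction arbitrary: z rule: evaluates.induct)
  case (comp xs gs ys f y)
  from comp.prems obtain zs where zs: "list_all2 (\<lambda>g y. evaluates g xs y) gs zs" "evaluates f zs z"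
    by (auto elim: evaluates_CompE)
  have "ys = zs"
    using comp.IH(1) zs(1) by (auto simp: list_all2_conv_all_nth intro: nth_equalityI)
  then show ?case using comp.IH(2) zs(2) by simp
next
  case (mu f n xs)
  from mu.prems have z: "evaluates f (z # xs) 0" "\<forall>k<z. \<exists>r>0. evaluates f (k # xs) r"
    by (auto elim: evaluates_MuE)
  show ?case
  \<comment> \<open>At the smaller of two different candidates \<open>f\<close> would have both the
    value 0 and a positive value.\<close>
  proof (cases n z rule: linorder_cases)
    case less
    then show ?thesis using mu.IH(1) z(2) by fastforce
  next
    case greater
    then show ?thesis using mu.IH(2) z(1) by fastforce
  qed
next
  case (primrec_0 f xs y g)
  from primrec_0.prems show ?case by (rule evaluates_PrimRec_0E) (rule primrec_0.IH)
next
  case (primrec_Suc f g n xs r y)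
  from primrec_Suc.prems obtain r' where "evaluates (PrimRec f g) (n # xs) r'" "evaluates g (n # r' # xs) z"
    by (rule evaluates_PrimRec_SucE)
  with primrec_Suc.IH show ?case by blast
qed (auto elim: evaluates_ZeroE evaluates_SuccE evaluates_ProjE)

text \<open>A computation by recursion is the finite sequence of its intermediate values;
  \<open>beta\<close> replaces the quantifier over sequences by one over two numbers.\<close>

lemma evaluates_PrimRec_iff:
  "evaluates (PrimRec f g) (n # xs) y \<longleftrightarrow>
    (\<exists>c d. evaluates f xs (beta c d 0) \<and>
      (\<forall>i<n. evaluates g (i # beta c d i # xs) (beta c d (Suc i))) \<and> y = beta c d n)"
proof
  assume "evaluates (PrimRec f g) (n # xs) y"
  then have "\<exists>a. evaluates f xs (a 0) \<and> (\<forall>i<n. evaluates g (i # a i # xs) (a (Suc i))) \<and> y = a n"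
  proof (induction n arbitrary: y)
    case 0
    then show ?case by (intro exI[of _ "\<lambda>_. y"]) (auto elim: evaluates_PrimRec_0E)
  next
    case (Suc n)
    from Suc.prems obtain r where r: "evaluates (PrimRec f g) (n # xs) r" "evaluates g (n # r # xs) y"
      by (rule evaluates_PrimRec_SucE)
    from Suc.IH[OF r(1)] obtain a where "evaluates f xs (a 0)"
      "\<forall>i<n. evaluates g (i # a i # xs) (a (Suc i))" "r = a n" by blast
    with r(2) show ?case
      by (intro exI[of _ "a(Suc n := y)"]) (auto simp: less_Suc_eq)
  qed
  then obtain a where a: "evaluates f xs (a 0)" "\<forall>i<n. evaluates g (i # a i # xs) (a (Suc i))" "y = a n"
    by blast
  \<comment> \<open>There are \<open>Suc n\<close> values to code, from index 0 to the result at
    index \<open>n\<close>.\<close>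
  obtain c d where cd: "\<forall>i<Suc n. beta c d i = a i" using beta_surj by blast
  show "\<exists>c d. evaluates f xs (beta c d 0) \<and>
      (\<forall>i<n. evaluates g (i # beta c d i # xs) (beta c d (Suc i))) \<and> y = beta c d n"
    using a cd by (intro exI[of _ c] exI[of _ d]) auto
next
  assume "\<exists>c d. evaluates f xs (beta c d 0) \<and>
      (\<forall>i<n. evaluates g (i # beta c d i # xs) (beta c d (Suc i))) \<and> y = beta c d n"
  then obtain c d where cd: "evaluates f xs (beta c d 0)"
    "\<forall>i<n. evaluates g (i # beta c d i # xs) (beta c d (Suc i))" "y = beta c d n" by blast
  have "i \<le> n \<Longrightarrow> evaluates (PrimRec f g) (i # xs) (beta c d i)" for i
    by (induction i) (use cd in \<open>auto intro: evaluates.intros\<close>)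
  then show "evaluates (PrimRec f g) (n # xs) y" using cd(3) by simp
qed

lemma evaluates_Comp_iff:
  "evaluates (Comp f gs) xs z \<longleftrightarrow>
    (\<exists>ys. length ys = length gs \<and> (\<forall>i\<in>{..<length gs}. evaluates (gs ! i) xs (ys ! i)) \<and> evaluates f ys z)"
  by (auto simp: list_all2_conv_all_nth elim!: evaluates_CompE intro!: evaluates.comp)

lemma evaluates_Mu_iff:
  "evaluates (Mu f) xs n \<longleftrightarrow>
    evaluates f (n # xs) 0 \<and> (\<forall>k. k < n \<longrightarrow> (\<exists>r. 0 < r \<and> evaluates f (k # xs) r))"
  by (auto elim!: evaluates_MuE intro!: evaluates.mu)

lemma definable_tail:
  assumes "definable (Suc k) R" "\<And>n ns. length ns = k \<Longrightarrow> R (n # ns) \<longleftrightarrow> R' (n # ns)"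
  shows "definable (Suc k) R'"
  using assms by (subst definable_cong[where R' = R]) (auto simp: length_Suc_conv)

text \<open>Induction on \<open>f\<close>, for all arities together, because
  \<open>evaluates\<close> accepts argument lists of any length; where the arity does not fit, the
  graph is empty.\<close>

lemma representable: "representable f"
proof (induction f)
  case Zero
  have "evaluates Zero xs y \<longleftrightarrow> y = 0" for xs y
    by (auto elim: evaluates_ZeroE intro: evaluates.intros)
  then show ?case
    unfolding representable_def by (auto intro!: definable_intros)
next
  case Succ
  show ?case
    unfolding representable_def
  proof
    fix k
    show "definable (Suc k) (\<lambda>ns. evaluates Succ (tl ns) (hd ns))"
    proof (cases "k = 1")
      case True
      have "definable (Suc k) (\<lambda>ns. hd ns = Suc (ns ! 1))"
        using True by (intro definable_intros) simp
      then show ?thesis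
        by (rule definable_tail)
          (auto simp: True length_Suc_conv elim: evaluates_SuccE intro: evaluates.intros)
    next
      case False
      show ?thesis
        by (rule definable_tail[OF definable_False]) (use False in \<open>auto elim: evaluates_SuccE\<close>)
    qed
  qed
next
  case (Proj i)
  show ?case
    unfolding representable_def
  proof
    fix k
    show "definable (Suc k) (\<lambda>ns. evaluates (Proj i) (tl ns) (hd ns))"
    proof (cases "i < k")
      case True
      have "definable (Suc k) (\<lambda>ns. hd ns = ns ! Suc i)"
        using True by (intro definable_intros) simp
      then show ?thesis
        by (rule definable_tail) (use True in \<open>auto elim: evaluates_ProjE intro: evaluates.intros\<close>)
    next
      case False
      show ?thesis
        by (rule definable_tail[OF definable_False]) (use False in \<open>auto elim: evaluates_ProjE\<close>)
    qed
  qed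
next
  case (Comp f gs)
  show ?case
    unfolding representable_def
  proof
    fix k
    let ?l = "length gs"
    \<comment> \<open>The intermediate values occupy the positions below \<open>?l\<close>, the
      result stands at \<open>?l\<close>, and the arguments follow.\<close>
    have "definable (?l + Suc k) (\<lambda>ns. evaluates (gs ! i) (map (\<lambda>s. s ns) (map (\<lambda>j ns. ns ! j) [Suc ?l..<?l + Suc k])) (ns ! i))"
      if "i < ?l" for i
      using that Comp.IH(2)[of "gs ! i"]
      by (intro definable_evaluates definable_fun_nth) (auto intro: definable_fun_nth)
    then have "definable (?l + Suc k) (\<lambda>ns. \<forall>i\<in>{..<?l}.
        evaluates (gs ! i) (map (\<lambda>s. s ns) (map (\<lambda>j ns. ns ! j) [Suc ?l..<?l + Suc k])) (ns ! i))"
      by (rule definable_finite_all[OF finite_lessThan]) (simp del: upt_Suc)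
    moreover have "definable (?l + Suc k) (\<lambda>ns. evaluates f (map (\<lambda>s. s ns) (map (\<lambda>j ns. ns ! j) [0..<?l])) (ns ! ?l))"
      using Comp.IH(1) by (intro definable_evaluates) (auto intro: definable_fun_nth)
    ultimately have "definable (?l + Suc k) (\<lambda>ns.
        (\<forall>i\<in>{..<?l}. evaluates (gs ! i) (map (\<lambda>s. s ns) (map (\<lambda>j ns. ns ! j) [Suc ?l..<?l + Suc k])) (ns ! i)) \<and>
        evaluates f (map (\<lambda>s. s ns) (map (\<lambda>j ns. ns ! j) [0..<?l])) (ns ! ?l))"
      by (rule definable_conj)
    from definable_ex_list[OF this]
    show "definable (Suc k) (\<lambda>ns. evaluates (Comp f gs) (tl ns) (hd ns))"
    proof (rule definable_tail, goal_cases)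
      case (1 n ns)
      have "map (\<lambda>s. s (ys @ n # ns)) (map (\<lambda>j ns. ns ! j) [Suc ?l..<?l + Suc k]) = ns"
        "map (\<lambda>s. s (ys @ n # ns)) (map (\<lambda>j ns. ns ! j) [0..<?l]) = ys"
        if "length ys = ?l" for ys
        using that 1 by (auto intro!: nth_equalityI simp: nth_append simp del: upt_Suc)
      then show ?case
        unfolding evaluates_Comp_iff list.sel
        by (intro ex_cong1 conj_cong refl) (simp_all add: nth_append del: upt_Suc)
    qed
  qed
next
  case (PrimRec f g)
  show ?case
    unfolding representable_def
  proof
    fix k
    show "definable (Suc k) (\<lambda>ns. evaluates (PrimRec f g) (tl ns) (hd ns))"
    proof (cases k)
      case 0
      show ?thesis
        by (rule definable_tail[OF definable_False]) (use 0 in \<open>auto elim: evaluates_PrimRecE\<close>)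
    next
      case (Suc l)
      \<comment> \<open>The tuple consists of \<open>d\<close>, \<open>c\<close>, the result, the
        recursion argument and the other arguments; in the next formula the step index comes in
        front of these.\<close>
      have "definable (4 + l) (\<lambda>ns. evaluates f (map (\<lambda>s. s ns) [] @ drop 4 ns) (beta (ns ! 1) (ns ! 0) 0))"
        by (intro definable_evaluates_drop[OF PrimRec.IH(1)] definable_fun_beta definable_intros) auto
      moreover have "definable (5 + l) (\<lambda>ns. ns ! 0 < ns ! 4 \<longrightarrow>
          evaluates g (map (\<lambda>s. s ns) [\<lambda>ns. ns ! 0, \<lambda>ns. beta (ns ! 2) (ns ! 1) (ns ! 0)] @ drop 5 ns)
            (beta (ns ! 2) (ns ! 1) (Suc (ns ! 0))))"
        by (intro definable_imp definable_less definable_evaluates_drop[OF PrimRec.IH(2)])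
          (auto intro!: definable_fun_beta definable_fun_nth definable_fun_Suc)
      then have "definable (Suc (4 + l)) (\<lambda>ns. ns ! 0 < ns ! 4 \<longrightarrow>
          evaluates g (map (\<lambda>s. s ns) [\<lambda>ns. ns ! 0, \<lambda>ns. beta (ns ! 2) (ns ! 1) (ns ! 0)] @ drop 5 ns)
            (beta (ns ! 2) (ns ! 1) (Suc (ns ! 0))))"
        by simp
      note definable_all[OF this]
      moreover have "definable (4 + l) (\<lambda>ns. ns ! 2 = beta (ns ! 1) (ns ! 0) (ns ! 3))"
        by (intro definable_eqI definable_fun_beta definable_fun_nth) auto
      ultimately have "definable (Suc (Suc (Suc k))) (\<lambda>ns. evaluates f (drop 4 ns) (beta (ns ! 1) (ns ! 0) 0) \<and>
          (\<forall>i. i < ns ! 3 \<longrightarrow> evaluates g (i # beta (ns ! 1) (ns ! 0) i # drop 4 ns) (beta (ns ! 1) (ns ! 0) (Suc i))) \<and>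
          ns ! 2 = beta (ns ! 1) (ns ! 0) (ns ! 3))"
        by (auto intro!: definable_conj simp: Suc eval_nat_numeral)
      from definable_ex[OF definable_ex[OF this]]
      show ?thesis
        by (rule definable_tail)
          (auto simp: Suc length_Suc_conv evaluates_PrimRec_iff eval_nat_numeral, blast)
    qed
  qed
next
  case (Mu f)
  show ?case
    unfolding representable_def
  proof
    fix k
    \<comment> \<open>The tuple consists of the positive value \<open>r\<close>, the smaller
      candidate \<open>i\<close>, the result and the arguments.\<close>
    have "definable (3 + k) (\<lambda>ns. 0 < ns ! 0 \<and> evaluates f (map (\<lambda>s. s ns) [\<lambda>ns. ns ! 1] @ drop 3 ns) (ns ! 0))"
      by (intro definable_conj definable_less definable_evaluates_drop[OF Mu] definable_intros)
        (auto intro!: definable_fun_nth)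
    then have "definable (Suc (2 + k)) (\<lambda>ns. 0 < ns ! 0 \<and> evaluates f (ns ! 1 # drop 3 ns) (ns ! 0))"
      by (simp add: eval_nat_numeral)
    from definable_ex[OF this] have "definable (2 + k) (\<lambda>ns. ns ! 0 < ns ! 1 \<longrightarrow> (\<exists>r. 0 < r \<and> evaluates f (ns ! 0 # drop 2 ns) r))"
      by (intro definable_imp definable_less definable_fun_nth) (auto simp: eval_nat_numeral)
    then have "definable (Suc (Suc k)) (\<lambda>ns. ns ! 0 < ns ! 1 \<longrightarrow> (\<exists>r. 0 < r \<and> evaluates f (ns ! 0 # drop 2 ns) r))"
      by simp
    from definable_all[OF this]
    have "definable (Suc k) (\<lambda>ns. \<forall>i. i < ns ! 0 \<longrightarrow> (\<exists>r. 0 < r \<and> evaluates f (i # drop 1 ns) r))"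
      by simp
    moreover have "definable (1 + k) (\<lambda>ns. evaluates f (map (\<lambda>s. s ns) [\<lambda>ns. ns ! 0] @ drop 1 ns) 0)"
      by (intro definable_evaluates_drop[OF Mu] definable_intros) (auto intro!: definable_fun_nth)
    ultimately have "definable (Suc k) (\<lambda>ns. evaluates f (ns ! 0 # drop 1 ns) 0 \<and>
        (\<forall>i. i < ns ! 0 \<longrightarrow> (\<exists>r. 0 < r \<and> evaluates f (i # drop 1 ns) r)))"
      by (intro definable_conj) simp_all
    then show "definable (Suc k) (\<lambda>ns. evaluates (Mu f) (tl ns) (hd ns))"
      by (rule definable_tail) (simp add: evaluates_Mu_iff)
  qed
qed

section \<open>Interpretation of arithmetic and diagonalisation\<close>

abbreviation exit_prob :: "svar \<Rightarrow> pexp" where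
  "exit_prob x \<equiv> Prob (Next (Atom 0 x))"

text \<open>The number \<open>n\<close> is represented by the probability \<open>1 / (n + 1)\<close>; the arithmetic atoms are
  cleared of denominators.\<close>

primrec translate :: "fo \<Rightarrow> form" where
  "translate (FAdd x y z) = Cmp CEq
     (Arith ATimes (Arith APlus (exit_prob x) (exit_prob y)) (exit_prob z))
     (Arith ATimes (Arith ATimes (exit_prob x) (exit_prob y)) (Arith APlus (Const 1) (exit_prob z)))"
| "translate (FMul x y z) = Cmp CEq
     (Arith ATimes (Arith ATimes (Arith AMinus (Const 1) (exit_prob x)) (Arith AMinus (Const 1) (exit_prob y))) (exit_prob z))
     (Arith ATimes (Arith ATimes (exit_prob x) (exit_prob y)) (Arith AMinus (Const 1) (exit_prob z)))"
| "translate (FNeg \<phi>) = Neg (translate \<phi>)"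
| "translate (FConj \<phi> \<psi>) = Conj (translate \<phi>) (translate \<psi>)"
| "translate (FEx z \<phi>) = StEx {|1|} {|z|} (Conj (nat_form z) (translate \<phi>))"

primrec fo_vars :: "fo \<Rightarrow> nat set" where
  "fo_vars (FAdd x y z) = {x, y, z}"
| "fo_vars (FMul x y z) = {x, y, z}"
| "fo_vars (FNeg \<phi>) = fo_vars \<phi>"
| "fo_vars (FConj \<phi> \<psi>) = fo_vars \<phi> \<union> fo_vars \<psi>"
| "fo_vars (FEx z \<phi>) = insert z (fo_vars \<phi>)"

lemma finite_fo_vars: "finite (fo_vars \<phi>)"
  by (induction \<phi>) auto

lemma wf_nat_form:
  assumes "V \<times> {1} \<subseteq> C" "x \<in> V"
  shows "wf_form (arena p) V C (nat_form x)"
  using assms by (simp add: nat_form_def steady_form_def)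

lemma wf_translate: "V \<times> {1} \<subseteq> C \<Longrightarrow> fo_vars \<phi> \<subseteq> V \<Longrightarrow> wf_form (arena p) V C (translate \<phi>)"
proof (induction \<phi> arbitrary: C)
  case (FEx z \<phi>)
  then have "V \<times> {1} \<subseteq> C \<union> {z} \<times> {1}" by auto
  with FEx show ?case by (simp add: wf_nat_form)
qed auto

lemma is_strategy_restrict:
  "is_strategy (arena p) {1} \<alpha> \<Longrightarrow> is_strategy (arena p) {1} (restrict_strategy (arena p) 1 \<alpha>)"
  by (simp add: is_strategy_arena restrict_strategy_def)

lemma codes_restrict: "codes (restrict_strategy (arena p) 1 \<alpha>) n \<longleftrightarrow> codes \<alpha> n"
  by (simp add: codes_def leave_def restrict_strategy_def)

lemma codes_counter: "codes (counter n) n"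
  using leave_counter[of n n] by (simp add: codes_def counter_def)

lemma strats_assign:
  "strats (assign (arena p) m {1} X \<alpha>) x = (if x \<in> X then restrict_strategy (arena p) 1 \<alpha> else strats m x)"
  by (simp add: assign_def)

lemma admissible_assign:
  assumes "admissible p V m v" "is_strategy (arena p) {1} \<alpha>"
  shows "admissible p V (assign (arena p) m {1} X \<alpha>) v"
  using assms is_strategy_restrict[OF assms(2)]
  unfolding admissible_def strats_assign by simp

text \<open>Since \<open>a + 1 = 1 / u\<close> and \<open>a = (1 - u) / u\<close>, the equations are
  \<open>1 / u + 1 / v = 1 / w + 1\<close> and
  \<open>(1 - u) / u * ((1 - v) / v) = (1 - w) / w\<close>, multiplied by
  \<open>u * v * w\<close>.\<close>

lemma arith_atoms:
  fixes a b c :: nat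
  defines "u \<equiv> 1 / (real a + 1)" and "v \<equiv> 1 / (real b + 1)" and "w \<equiv> 1 / (real c + 1)"
  shows "(u + v) * w = u * v * (1 + w) \<longleftrightarrow> a + b = c"
    and "(1 - u) * (1 - v) * w = u * v * (1 - w) \<longleftrightarrow> a * b = c"
proof -
  have nz: "real a + 1 \<noteq> 0" "real b + 1 \<noteq> 0" "real c + 1 \<noteq> 0" by simp_all
  have "(u + v) * w = u * v * (1 + w) \<longleftrightarrow> real a + real b = real c"
    unfolding u_def v_def w_def using nz by (simp add: divide_simps) (simp add: algebra_simps)
  then show "(u + v) * w = u * v * (1 + w) \<longleftrightarrow> a + b = c"
    by (simp only: of_nat_add[symmetric] of_nat_eq_iff)
  have "(1 - u) * (1 - v) * w = u * v * (1 - w) \<longleftrightarrow> real a * real b = real c"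
    unfolding u_def v_def w_def using nz by (simp add: divide_simps)
  then show "(1 - u) * (1 - v) * w = u * v * (1 - w) \<longleftrightarrow> a * b = c"
    by (simp only: of_nat_mult[symmetric] of_nat_eq_iff)
qed

text \<open>\<open>X\<close> holds variables placed in state 0; \<open>V\<close> may be larger,
  because in the final formula one further variable is placed in state 1.\<close>

lemma sat_translate:
  assumes "admissible p V m v" "X \<subseteq> V" "fo_vars \<phi> \<subseteq> X" "\<And>x. x \<in> X \<Longrightarrow> v x = Some 0"
    and "\<And>x. x \<in> X \<Longrightarrow> codes (strats m x) (e x)"
  shows "sat (arena p) m v (translate \<phi>) \<longleftrightarrow> fo_sat e \<phi>"
  using assms(1,3,5)
proof (induction \<phi> arbitrary: m e)
  case (FAdd x y z)
  have "val (arena p) m v (exit_prob u) = 1 / (real (e u) + 1)" if "u \<in> {x, y, z}" for u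
    using val_Next_end[OF FAdd.prems(1), of u] that FAdd.prems(2,3) assms(2,4)
    by (auto simp: codes_def subset_iff)
  then show ?case
    by (simp only: translate.simps sat.simps val.simps(2,3) arith_sem.simps cmp_sem.simps fo_sat.simps
        insert_iff simp_thms of_rat_1 arith_atoms)
next
  case (FMul x y z)
  have "val (arena p) m v (exit_prob u) = 1 / (real (e u) + 1)" if "u \<in> {x, y, z}" for u
    using val_Next_end[OF FMul.prems(1), of u] that FMul.prems(2,3) assms(2,4)
    by (auto simp: codes_def subset_iff)
  then show ?case
    by (simp only: translate.simps sat.simps val.simps(2,3) arith_sem.simps cmp_sem.simps fo_sat.simps
        insert_iff simp_thms of_rat_1 arith_atoms)
next
  case (FConj \<phi> \<psi>)
  from FConj.IH(1)[of m e] FConj.IH(2)[of m e] FConj.prems show ?case by simp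
next
  case (FEx z \<phi>)
  let ?m = "assign (arena p) m {1} {z}"
  have z: "z \<in> V" "v z = Some 0" and \<phi>: "fo_vars \<phi> \<subseteq> X"
    using FEx.prems(2) assms(2,4) by auto
  have IH: "sat (arena p) (?m \<alpha>) v (translate \<phi>) \<longleftrightarrow> fo_sat (e(z := n)) \<phi>"
    if "is_strategy (arena p) {1} \<alpha>" "codes (restrict_strategy (arena p) 1 \<alpha>) n" for \<alpha> n
  proof (rule FEx.IH[OF admissible_assign[OF FEx.prems(1) that(1)] \<phi>])
    show "codes (strats (?m \<alpha>) x) ((e(z := n)) x)" if "x \<in> X" for x
      using FEx.prems(3)[OF that] \<open>codes (restrict_strategy (arena p) 1 \<alpha>) n\<close>
      unfolding strats_assign by simp
  qed
  have "sat (arena p) m v (translate (FEx z \<phi>)) \<longleftrightarrow>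
      (\<exists>\<alpha>. is_strategy (arena p) {1} \<alpha> \<and> sat (arena p) (?m \<alpha>) v (nat_form z) \<and> sat (arena p) (?m \<alpha>) v (translate \<phi>))"
    by simp
  \<comment> \<open>The quantifiers match: a strategy satisfying \<open>nat_form\<close> codes some
    number, and every number is coded by its \<open>counter\<close>.\<close>
  also have "\<dots> \<longleftrightarrow> (\<exists>n. fo_sat (e(z := n)) \<phi>)"
  proof
    assume "\<exists>\<alpha>. is_strategy (arena p) {1} \<alpha> \<and> sat (arena p) (?m \<alpha>) v (nat_form z) \<and> sat (arena p) (?m \<alpha>) v (translate \<phi>)"
    then obtain \<alpha> where \<alpha>: "is_strategy (arena p) {1} \<alpha>" "sat (arena p) (?m \<alpha>) v (nat_form z)" "sat (arena p) (?m \<alpha>) v (translate \<phi>)"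
      by blast
    obtain n where "codes (strats (?m \<alpha>) z) n"
      using sat_nat_formD[OF admissible_assign[OF FEx.prems(1) \<alpha>(1)] z \<alpha>(2)] ..
    then have "codes (restrict_strategy (arena p) 1 \<alpha>) n" unfolding strats_assign by simp
    from IH[OF \<alpha>(1) this] \<alpha>(3) show "\<exists>n. fo_sat (e(z := n)) \<phi>" by blast
  next
    assume "\<exists>n. fo_sat (e(z := n)) \<phi>"
    then obtain n where n: "fo_sat (e(z := n)) \<phi>" ..
    have "strats (?m (counter n)) z = restrict_strategy (arena p) 1 (counter n)"
      unfolding strats_assign by simp
    from sat_nat_form_counter(1)[OF admissible_assign[OF FEx.prems(1) is_strategy_counter] z this]
      IH[OF is_strategy_counter, of n n] n is_strategy_counter[of p n]
    show "\<exists>\<alpha>. is_strategy (arena p) {1} \<alpha> \<and> sat (arena p) (?m \<alpha>) v (nat_form z) \<and> sat (arena p) (?m \<alpha>) v (translate \<phi>)"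
      unfolding codes_restrict using codes_counter by blast
  qed
  finally show ?case by simp
qed simp_all

section \<open>The formula that reads the parameter of the game\<close>

definition starts :: "nat \<Rightarrow> form" where
  "starts N = Conj (foldr (\<lambda>x. Conj (Neg (Atom 0 x))) [0..<N] TT) (Atom 1 N)"

text \<open>Variable \<open>N\<close> starts in state 1 and reads \<open>p\<close> off the game.\<close>

definition instance_form :: "nat \<Rightarrow> fo \<Rightarrow> form" where
  "instance_form N \<phi> = StEx {|1|} (fset_of_list [0..<Suc N])
     (Conj (starts N) (Conj (Cmp CEq (exit_prob 0) (Prob (Next (Atom 1 N)))) (translate \<phi>)))"

definition instance_hform :: "nat \<Rightarrow> fo \<Rightarrow> hform" where
  "instance_hform N \<phi> = foldr Ex [0..<Suc N] (Matrix (instance_form N \<phi>))"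

lemma hsat_foldr_Ex:
  "hsat G v (foldr Ex xs \<phi>) \<longleftrightarrow>
    (\<exists>w. (\<forall>x\<in>set xs. w x \<in> states G) \<and> hsat G (\<lambda>x. if x \<in> set xs then Some (w x) else v x) \<phi>)"
proof (induction xs arbitrary: v)
  case (Cons x xs)
  let ?u = "\<lambda>xs w v x. if x \<in> set xs then Some (w x) else v x"
  show ?case
  proof
    assume "hsat G v (foldr Ex (x # xs) \<phi>)"
    then obtain s w where *: "s \<in> states G" "\<forall>x\<in>set xs. w x \<in> states G" "hsat G (?u xs w (v(x \<mapsto> s))) \<phi>"
      by (auto simp: Cons.IH)
    \<comment> \<open>If \<open>x\<close> occurs again in \<open>xs\<close>, the inner quantifier
      overrides the choice \<open>s\<close>.\<close>
    let ?w = "\<lambda>y. if y \<in> set xs then w y else s"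
    have "?u xs w (v(x \<mapsto> s)) = ?u (x # xs) ?w v" by auto
    with * show "\<exists>w. (\<forall>x\<in>set (x # xs). w x \<in> states G) \<and> hsat G (?u (x # xs) w v) \<phi>"
      by (intro exI[of _ ?w]) (simp del: fun_upd_apply)
  next
    assume "\<exists>w. (\<forall>x\<in>set (x # xs). w x \<in> states G) \<and> hsat G (?u (x # xs) w v) \<phi>"
    then obtain w where *: "\<forall>x\<in>set (x # xs). w x \<in> states G" "hsat G (?u (x # xs) w v) \<phi>" by blast
    have "?u (x # xs) w v = ?u xs w (v(x \<mapsto> w x))" by auto
    with * have "hsat G (v(x \<mapsto> w x)) (foldr Ex xs \<phi>)"
      unfolding Cons.IH by (intro exI[of _ w]) (simp del: fun_upd_apply)
    with * show "hsat G v (foldr Ex (x # xs) \<phi>)" by auto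
  qed
qed simp

text \<open>State quantifiers range over all three states, and labels single out the intended ones:
  only state 0 lacks atom 0, and only state 1 has atom 1.\<close>

lemma sat_starts:
  assumes "\<And>x. x \<le> N \<Longrightarrow> v x = Some (w x) \<and> w x < 3"
  shows "sat (arena p) m v (starts N) \<longleftrightarrow> (\<forall>x<N. w x = 0) \<and> w N = 1"
proof -
  have "sat (arena p) m v (foldr (\<lambda>x. Conj (Neg (Atom 0 x))) xs TT) \<longleftrightarrow> (\<forall>x\<in>set xs. 0 \<notin> label (arena p) (the (v x)))" for xs
    by (induction xs) auto
  moreover have "0 \<notin> label (arena p) (the (v x)) \<longleftrightarrow> w x = 0" if "x \<le> N" for x
    using assms[OF that] label_arena(1)[of "w x"] by auto
  moreover have "1 \<in> label (arena p) (the (v N)) \<longleftrightarrow> w N = 1"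
    using assms[of N] label_arena(2)[of "w N"] by simp
  ultimately show ?thesis by (auto simp: starts_def)
qed

text \<open>The outer quantifier gives one strategy to all variables. Once the comparison with
  variable \<open>N\<close> forces variable 0 to code \<open>p\<close>, every variable below
  \<open>N\<close> codes \<open>p\<close>, hence the constant assignment.\<close>

lemma models_instance:
  assumes "fo_vars \<phi> \<subseteq> {..<N}" "0 < N"
  shows "models (arena p) (instance_hform N \<phi>) \<longleftrightarrow> fo_sat (\<lambda>_. p) \<phi>"
proof -
  let ?v = "\<lambda>w x. if x \<in> set [0..<Suc N] then Some (w x) else (None :: state option)"
  let ?m = "assign (arena p) (\<lambda>_. Map.empty) {1} (set [0..<Suc N])"
  have key: "sat (arena p) (?m \<alpha>) (?v w) (starts N) \<Longrightarrow>
      (val (arena p) (?m \<alpha>) (?v w) (exit_prob 0) = val (arena p) (?m \<alpha>) (?v w) (Prob (Next (Atom 1 N))) \<longleftrightarrow> codes \<alpha> p) \<and>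
      (codes \<alpha> p \<longrightarrow> (sat (arena p) (?m \<alpha>) (?v w) (translate \<phi>) \<longleftrightarrow> fo_sat (\<lambda>_. p) \<phi>))"
    if w: "\<forall>x\<in>set [0..<Suc N]. w x \<in> {..<3}" and \<alpha>: "is_strategy (arena p) {1} \<alpha>" for w \<alpha>
  proof -
    assume "sat (arena p) (?m \<alpha>) (?v w) (starts N)"
    then have wN: "\<And>x. x < N \<Longrightarrow> w x = 0" "w N = 1"
      using w by (auto simp: sat_starts[where w = w])
    have strats: "strats (?m \<alpha>) x = restrict_strategy (arena p) 1 \<alpha>" if "x \<le> N" for x
      unfolding strats_assign using that by simp
    have adm: "admissible p {..N} (?m \<alpha>) (?v w)"
      using w is_strategy_restrict[OF \<alpha>] strats by (auto simp: admissible_def dom_def)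
    have "val (arena p) (?m \<alpha>) (?v w) (exit_prob 0) = leave \<alpha> (init \<alpha> 0)"
      using val_Next_end[OF adm, of 0] wN assms(2) strats[of 0]
      by (simp add: leave_def restrict_strategy_def del: val.simps(1))
    moreover have "val (arena p) (?m \<alpha>) (?v w) (Prob (Next (Atom 1 N))) = 1 / (real p + 1)"
      using val_Next_acc_1[OF adm, of N] wN by (simp del: val.simps(1))
    moreover have "sat (arena p) (?m \<alpha>) (?v w) (translate \<phi>) \<longleftrightarrow> fo_sat (\<lambda>_. p) \<phi>" if "codes \<alpha> p"
    proof (rule sat_translate[OF adm _ assms(1)])
      show "codes (strats (?m \<alpha>) x) p" if "x \<in> {..<N}" for x
        using \<open>codes \<alpha> p\<close> strats[of x] that by (simp add: codes_restrict[unfolded One_nat_def])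
    qed (use wN in auto)
    ultimately show ?thesis by (simp only: codes_def) blast
  qed
  have "models (arena p) (instance_hform N \<phi>) \<longleftrightarrow>
      (\<exists>w. (\<forall>x\<in>set [0..<Suc N]. w x \<in> {..<3}) \<and> (\<exists>\<alpha>. is_strategy (arena p) {1} \<alpha> \<and>
        sat (arena p) (?m \<alpha>) (?v w) (starts N) \<and>
        val (arena p) (?m \<alpha>) (?v w) (exit_prob 0) = val (arena p) (?m \<alpha>) (?v w) (Prob (Next (Atom 1 N))) \<and>
        sat (arena p) (?m \<alpha>) (?v w) (translate \<phi>)))"
    unfolding models_def instance_hform_def hsat_foldr_Ex instance_form_def
    by (simp add: fset_of_list.rep_eq del: upt_Suc val.simps(1))
  also have "\<dots> \<longleftrightarrow> fo_sat (\<lambda>_. p) \<phi>" (is "?L \<longleftrightarrow> _")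
  proof
    assume ?L
    then show "fo_sat (\<lambda>_. p) \<phi>" using key by blast
  next
    assume \<phi>: "fo_sat (\<lambda>_. p) \<phi>"
    \<comment> \<open>Witnesses: variable \<open>N\<close> starts in state 1, the others in state 0,
      and the strategy is the counter for \<open>p\<close>.\<close>
    let ?w = "\<lambda>x. if x = N then 1 else 0 :: state"
    have w: "\<forall>x\<in>set [0..<Suc N]. ?w x \<in> {..<3}" by simp
    have "sat (arena p) (?m (counter p)) (?v ?w) (starts N)"
      by (subst sat_starts[where w = ?w]) auto
    with key[OF w is_strategy_counter this] \<phi> codes_counter[of p] is_strategy_counter[of p p] w
    show ?L by (intro exI[of _ ?w] exI[of _ "counter p"]) blast
  qed
  finally show ?thesis .
qed

lemma wf_foldr_Ex: "wf_hform G V (foldr Ex xs \<phi>) \<longleftrightarrow> wf_hform G (set xs \<union> V) \<phi>"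
  by (induction xs arbitrary: V) auto

lemma well_formed_instance:
  assumes "fo_vars \<phi> \<subseteq> {..<N}"
  shows "well_formed (arena p) (instance_hform N \<phi>)"
proof -
  let ?V = "set [0..<Suc N]"
  have "wf_form (arena p) ?V C (foldr (\<lambda>x. Conj (Neg (Atom 0 x))) xs TT)" if "set xs \<subseteq> ?V" for xs C
    using that by (induction xs) (auto simp del: upt_Suc)
  from this[of "[0..<N]"] have "wf_form (arena p) ?V C (starts N)" for C
    by (simp add: starts_def subset_insertI)
  moreover have "wf_form (arena p) ?V (?V \<times> {1}) (translate \<phi>)"
    using assms by (intro wf_translate) auto
  ultimately show ?thesis
    by (simp add: well_formed_def instance_hform_def wf_foldr_Ex instance_form_def fset_of_list.rep_eq del: upt_Suc)
qed

section \<open>Arithmetical definition of instance codes\<close>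

lemma quotient_of_divide:
  fixes a b :: int
  assumes "0 < b" "coprime a b"
  shows "quotient_of (of_int a / of_int b) = (a, b)"
  using assms by (simp add: Fract_of_int_quotient[symmetric] quotient_of_Fract normalize_stable)

lemma code_rat_divide:
  assumes "coprime a b" "0 < b"
  shows "code_rat (of_nat a / of_nat b) = prod_encode (2 * a, 2 * b)"
  using quotient_of_divide[of "int b" "int a"] assms
  by (simp add: code_rat_def int_encode_def sum_encode_def)

text \<open>The fractions with denominator \<open>p + 1\<close> are already in lowest terms, so
  \<open>p\<close> enters the code only through \<open>2 * p\<close> and \<open>2 * Suc p\<close>,
  the codes of the integers \<open>p\<close> and \<open>p + 1\<close>.\<close>

lemma code_game_game:
  "code_game (game p) =
    (let z = code_rat 0; l = list_encode [z, z, code_rat 1] in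
     list_encode [1, list_encode [1, 1, 1], 3,
       list_encode
         [list_encode [list_encode [code_rat 1, z, z], list_encode [z, code_rat 1, z], l],
          let r = list_encode [z, prod_encode (2, 2 * Suc p), prod_encode (2 * p, 2 * Suc p)] in list_encode [r, r, r],
          list_encode [l, l, l]],
       2, list_encode (map code_fset [{||}, {|0, 1|}, {|0|}])])"
proof -
  have "code_rat (1 / of_nat (p + 1)) = prod_encode (2, 2 * Suc p)"
    using code_rat_divide[of 1 "Suc p"] by simp
  moreover have "code_rat (of_nat p / of_nat (p + 1)) = prod_encode (2 * p, 2 * Suc p)"
    using code_rat_divide[of p "Suc p"] by simp
  ultimately show ?thesis
    by (simp add: code_game_def game_def Let_def numeral_3_eq_3 del: list_encode.simps of_nat_Suc)
qed

text \<open>The code of a pair is a triangular number plus the first component; the equation for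
  twice the triangular number avoids division.\<close>

lemma definable_fun_prod_encode:
  assumes "definable_fun k s" "definable_fun k t"
  shows "definable_fun k (\<lambda>ns. prod_encode (s ns, t ns))"
proof -
  have "definable_fun k (\<lambda>ns. triangle (s ns + t ns))"
  proof (rule definable_funI)
    show "definable (Suc k) (\<lambda>ns. 2 * hd ns = (s (tl ns) + t (tl ns)) * Suc (s (tl ns) + t (tl ns)))"
      by (intro definable_intros assms)
    have "2 * triangle n = n * Suc n" for n
      by (simp add: triangle_def)
    then show "2 * hd (n # ns) = (s (tl (n # ns)) + t (tl (n # ns))) * Suc (s (tl (n # ns)) + t (tl (n # ns))) \<longleftrightarrow>
        n = triangle (s ns + t ns)" for n ns
      by (metis list.sel(1,3) mult_left_cancel zero_neq_numeral)
  qed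
  then show ?thesis
    unfolding prod_encode_def by (simp add: definable_fun_plus assms)
qed

lemma definable_fun_list_encode_Cons:
  "definable_fun k s \<Longrightarrow> definable_fun k (\<lambda>ns. list_encode (l ns)) \<Longrightarrow>
    definable_fun k (\<lambda>ns. list_encode (s ns # l ns))"
  by (simp add: definable_fun_Suc definable_fun_prod_encode)

lemma definable_fun_code_game: "definable_fun (Suc k) (\<lambda>ns. code_game (game (hd ns)))"
  unfolding code_game_game Let_def
  by (intro definable_fun_const definable_fun_list_encode_Cons definable_fun_prod_encode
      definable_fun_times definable_fun_Suc definable_fun_hd)

theorem theorem3:
  shows "\<not> decidable_problem code_instance mc_instances mc_holds"
proof
  assume "decidable_problem code_instance mc_instances mc_holds"
  then obtain f where f: "\<And>i. i \<in> mc_instances \<Longrightarrow> evaluates f [code_instance i] (if mc_holds i then 1 else 0)"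
    unfolding decidable_problem_def by blast
  \<comment> \<open>A property of one number: \<open>f\<close> rejects the game with that parameter
    paired with the formula that has that code.\<close>
  have "definable 1 (\<lambda>ns. evaluates f (map (\<lambda>s. s ns) [\<lambda>ns. prod_encode (code_game (game (hd ns)), hd ns)]) 0)"
    using definable_fun_code_game[of 0] definable_fun_hd[of 0]
    by (intro definable_evaluates representable) (auto intro: definable_fun_prod_encode definable_fun_const)
  from this[unfolded definable_def, rule_format, of "[0]"]
  obtain \<phi> where \<phi>: "\<And>e. fo_sat e \<phi> \<longleftrightarrow> evaluates f [prod_encode (code_game (game (e 0)), e 0)] 0"
    by auto
  obtain N where "\<forall>n\<in>fo_vars \<phi>. n < N"
    using finite_fo_vars finite_nat_set_iff_bounded by blast
  \<comment> \<open>The successor makes the bound positive, as \<open>models_instance\<close>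
    requires.\<close>
  then have N: "fo_vars \<phi> \<subseteq> {..<Suc N}" by auto
  \<comment> \<open>\<open>\<phi>\<close> and \<open>N\<close> were obtained without reference to
    \<open>p\<close>, so \<open>p\<close> can be the code of the finished formula; the code of
    \<open>?i\<close> is then the very number that \<open>\<phi>\<close> speaks about when variable
    0 has the value \<open>p\<close>.\<close>
  define p where "p = code_hform (instance_hform (Suc N) \<phi>)"
  let ?i = "(game p, instance_hform (Suc N) \<phi>)"
  have i: "?i \<in> mc_instances"
    using is_fin_game_game well_formed_instance[OF N] by (simp add: mc_instances_def)
  have "mc_holds ?i \<longleftrightarrow> evaluates f [code_instance ?i] 0"
    using models_instance[OF N] \<phi>[of "\<lambda>_. p"] by (simp add: mc_holds_def code_instance_def p_def)
  \<comment> \<open>The instance holds iff \<open>f\<close> yields 0 on it, whereas \<open>f\<close>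
    yields 1 on instances that hold and 0 on the others; values of \<open>f\<close> are
    unique.\<close>
  with f[OF i] show False
    by (auto dest: evaluates_functional split: if_splits)
qed

end
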